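(* For every positive integer $n$, the mixed cycle $C_{2n+1}$ (all edges undirected) is determined by its Hermitian spectrum (DHS).
   Context: A mixed graph has undirected edges and directed edges (ordered pairs $(x,y)$). For vertices $v_1,\dots,v_n$, its Hermitian adjacency matrix $H(X)$ has $(j,k)$ entry $1$ if $v_jv_k$ is an undirected edge, $i$ if $(v_j,v_k)$ is a directed edge, $-i$ if $(v_k,v_j)$ is a directed edge, $0$ otherwise; $\mathrm{Spec}_H(X)$ is its multiset of eigenvalues. Mixed graphs $X,Y$ on the same vertex set are switching equivalent if $H(X)=D^{-1}H(Y)D$ for a diagonal $D$ with diagonal entries in $\{\pm1,\pm i\}$. A mixed graph $X$ is DHS if every mixed graph $Y$ with $\mathrm{Spec}_H(Y)=\mathrm{Spec}_H(X)$ is switching equivalent to a mixed graph isomorphic to $X$. $C_m$ is the cycle of order $m$ with all edges undirected. *)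

theory Defs
  imports Jordan_Normal_Form.Char_Poly
begin

text \<open>Following the entries of the Hermitian adjacency matrix, at most one kind of adjacency
  (undirected, forward arc, backward arc) may hold between two vertices, and there are no loops.\<close>

record 'a mixed_graph =
  verts :: "'a set"
  edges :: "'a set set"
  arcs :: "('a \<times> 'a) set"

definition mixed_graph :: "'a mixed_graph \<Rightarrow> bool" where
  "mixed_graph X \<longleftrightarrow>
     finite (verts X) \<and>
     (\<forall>e\<in>edges X. e \<subseteq> verts X \<and> card e = 2) \<and>
     arcs X \<subseteq> verts X \<times> verts X \<and>
     (\<forall>(x, y)\<in>arcs X. x \<noteq> y \<and> (y, x) \<notin> arcs X \<and> {x, y} \<notin> edges X)"

definition hermitian_entry :: "'a mixed_graph \<Rightarrow> 'a \<Rightarrow> 'a \<Rightarrow> complex" where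
  "hermitian_entry X x y =
     (if {x, y} \<in> edges X then 1
      else if (x, y) \<in> arcs X then \<i>
      else if (y, x) \<in> arcs X then - \<i>
      else 0)"

definition hermitian_matrix_wrt :: "'a list \<Rightarrow> 'a mixed_graph \<Rightarrow> complex mat" where
  "hermitian_matrix_wrt vs X =
     mat (length vs) (length vs) (\<lambda>(j, k). hermitian_entry X (vs ! j) (vs ! k))"

text \<open>The enumeration \<open>v\<^sub>1, \<dots>, v\<^sub>n\<close> of the vertices is an arbitrary one, but it depends only on
  the vertex set, so that graphs on the same vertex set have comparable matrices.\<close>

definition vertex_list :: "'a set \<Rightarrow> 'a list" where
  "vertex_list V = (SOME vs. set vs = V \<and> distinct vs)"

definition hermitian_matrix :: "'a mixed_graph \<Rightarrow> complex mat" where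
  "hermitian_matrix X = hermitian_matrix_wrt (vertex_list (verts X)) X"

definition spec_H :: "'a mixed_graph \<Rightarrow> complex multiset" where
  "spec_H X = proots (char_poly (hermitian_matrix X))"

definition switching_equivalent :: "'a mixed_graph \<Rightarrow> 'a mixed_graph \<Rightarrow> bool" where
  "switching_equivalent X Y \<longleftrightarrow>
     verts X = verts Y \<and>
     (\<exists>D D'. D \<in> carrier_mat (card (verts X)) (card (verts X)) \<and>
             D' \<in> carrier_mat (card (verts X)) (card (verts X)) \<and>
             diagonal_mat D \<and>
             (\<forall>j < card (verts X). D $$ (j, j) \<in> {1, -1, \<i>, -\<i>}) \<and>
             inverts_mat D D' \<and> inverts_mat D' D \<and>
             hermitian_matrix X = D' * hermitian_matrix Y * D)"

definition isomorphic :: "'a mixed_graph \<Rightarrow> 'b mixed_graph \<Rightarrow> bool" where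
  "isomorphic X Y \<longleftrightarrow>
     (\<exists>f. bij_betw f (verts X) (verts Y) \<and>
          (\<forall>x\<in>verts X. \<forall>y\<in>verts X.
             ({x, y} \<in> edges X \<longleftrightarrow> {f x, f y} \<in> edges Y) \<and>
             ((x, y) \<in> arcs X \<longleftrightarrow> (f x, f y) \<in> arcs Y)))"

text \<open>A definition cannot quantify over types, so the type \<open>'b\<close> of the vertices of the
  competing graphs is a parameter; it is independent of the vertex type of \<open>X\<close>.\<close>

definition DHS :: "'b itself \<Rightarrow> 'a mixed_graph \<Rightarrow> bool" where
  "DHS (_ :: 'b itself) X \<longleftrightarrow>
     mixed_graph X \<and>
     (\<forall>Y :: 'b mixed_graph. mixed_graph Y \<longrightarrow> spec_H Y = spec_H X \<longrightarrow>
        (\<exists>Z :: 'b mixed_graph. mixed_graph Z \<and> isomorphic Z X \<and> switching_equivalent Y Z))"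

text \<open>The cycle on \<open>{0..<m}\<close>, intended for \<open>m \<ge> 3\<close>.\<close>

definition undirected_cycle :: "nat \<Rightarrow> nat mixed_graph" where
  "undirected_cycle m =
     \<lparr>verts = {0..<m}, edges = (\<lambda>j. {j, (j + 1) mod m}) ` {0..<m}, arcs = {}\<rparr>"

lemma mixed_graph_undirected_cycle:
  assumes "m \<ge> 3"
  shows "mixed_graph (undirected_cycle m)"
proof -
  have "j \<noteq> Suc j mod m" if "j < m" for j
    using that assms by (cases "Suc j = m") auto
  moreover have "Suc j mod m < m" for j using assms by simp
  ultimately show ?thesis
    by (auto simp: mixed_graph_def undirected_cycle_def)
qed

lemma vertex_list:
  assumes "finite V"
  shows "set (vertex_list V) = V" "distinct (vertex_list V)" "length (vertex_list V) = card V"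
proof -
  have *: "set (vertex_list V) = V \<and> distinct (vertex_list V)"
    unfolding vertex_list_def by (rule someI_ex) (rule finite_distinct_list[OF assms])
  from * show "set (vertex_list V) = V" "distinct (vertex_list V)" by auto
  from * show "length (vertex_list V) = card V" using distinct_card by metis
qed

text \<open>The spectrum does not depend on the chosen enumeration.\<close>

lemma char_poly_hermitian_matrix_wrt:
  assumes "set vs = set ws" "distinct vs" "distinct ws"
  shows "char_poly (hermitian_matrix_wrt vs X) = char_poly (hermitian_matrix_wrt ws X)"
proof -
  define n where "n = length ws"
  have len: "length vs = n" using assms distinct_card n_def by metis
  have "mset vs = mset ws" using assms set_eq_iff_mset_eq_distinct by blast
  then obtain p where p: "p permutes {..<n}" "permute_list p ws = vs"
    using mset_eq_permutation n_def by metis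
  have nth: "vs ! i = ws ! p i" if "i < n" for i
    using permute_list_nth[of p ws i] p that n_def by auto
  have pn: "p i < n" if "i < n" for i using permutes_in_image[OF p(1), of i] that by auto
  have inj: "p i = p j \<longleftrightarrow> i = j" for i j using permutes_inj[OF p(1)] by (auto dest: injD)
  define q where "q = inv_into UNIV p"
  have q: "q permutes {..<n}" unfolding q_def by (rule permutes_inv[OF p(1)])
  have qn: "q i < n" if "i < n" for i using permutes_in_image[OF q, of i] that by auto
  have pq: "p (q i) = i" "q (p i) = i" for i
    unfolding q_def using permutes_inverses[OF p(1)] by auto
  let ?A = "hermitian_matrix_wrt vs X" and ?B = "hermitian_matrix_wrt ws X"
  let ?P = "mat n n (\<lambda>(i, j). if j = p i then 1 else 0 :: complex)"
  let ?Q = "mat n n (\<lambda>(i, j). if i = p j then 1 else 0 :: complex)"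
  have iff: "(i = p k) = (k = q i)" "(q i = q k) = (i = k)" for i k using pq by metis+
  have "?P * ?Q = 1\<^sub>m n"
    by (rule eq_matI) (auto simp: scalar_prod_def if_distrib[of "\<lambda>x. x * _"] pn inj cong: if_cong)
  moreover have "?Q * ?P = 1\<^sub>m n"
    by (rule eq_matI)
      (auto simp: scalar_prod_def if_distrib[of "\<lambda>x. x * _"] iff qn pq cong: if_cong)
  moreover have PB: "?P * ?B = mat n n (\<lambda>(i, j). hermitian_entry X (ws ! p i) (ws ! j))"
    by (rule eq_matI)
      (auto simp: hermitian_matrix_wrt_def n_def[symmetric] scalar_prod_def
        if_distrib[of "\<lambda>x. x * _"] pn cong: if_cong)
  have "?A = ?P * ?B * ?Q"
    unfolding PB
    by (rule eq_matI)
      (auto simp: hermitian_matrix_wrt_def n_def[symmetric] len scalar_prod_def nth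
        if_distrib[of "\<lambda>x. _ * x"] pn cong: if_cong)
  ultimately have "similar_mat_wit ?A ?B ?P ?Q"
    unfolding similar_mat_wit_def Let_def
    by (auto simp: hermitian_matrix_wrt_def len n_def)
  then show ?thesis by (metis char_poly_similar similar_mat_def)
qed

lemma spec_H_enumeration:
  assumes "distinct vs" "set vs = verts X"
  shows "spec_H X = proots (char_poly (hermitian_matrix_wrt vs X))"
proof -
  have "finite (verts X)" using assms(2) by (metis finite_set)
  from vertex_list(1,2)[OF this] show ?thesis
    using char_poly_hermitian_matrix_wrt[of "vertex_list (verts X)" vs X] assms
    by (simp add: spec_H_def hermitian_matrix_def)
qed

end

(* Let Y have the spectrum of C_m with m odd and let H be its Hermitian adjacency matrix. Hermitian
   matrices with the same characteristic polynomial are unitarily similar, so H is unitarily similar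
   to the adjacency matrix of C_m. This gives the following.
   - Y has m edges, by the trace of H^2.
   - The form x* (2 - H) x is nonnegative and vanishes on a single line only, spanned by an
     eigenvector; x* (2 + H) x vanishes only for x = 0.
   - As no eigenvalue of C_m is the negative of another one, H Z + Z H = 0 or H Z + Z H^T = 0
     forces Z = 0. Taking Z diagonal, the m x m signless incidence matrix of Y is injective, and so
     is its version twisted by the squares of the entries of H.
   A nonzero term of the determinant of the signless incidence matrix matches each vertex u with an
   edge {u, f u}, so the edges of Y are the pairs {u, f u} for a function f on the vertices, each
   arising once. Every component then contains exactly one cycle, a cycle of f. Its length is odd, as
   otherwise alternating signs on the component are in the kernel of the incidence matrix; its
   weight is not imaginary, as otherwise the twisted matrix has a kernel; and its weight is not -1,
   as otherwise a vector supported on the cycle attains the value -2. So the weight is 1, and a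
   vector supported exactly on the cycle attains the value 2. Such vectors are eigenvectors and
   proportional to each other, so there is one cycle only and no vertex outside of it. *)
theory Submission
  imports Defs Jordan_Normal_Form.Schur_Decomposition
begin

section \<open>Unitary diagonalization of Hermitian matrices\<close>

lemma mat_adjoint_dim [simp]:
  "dim_row (mat_adjoint A) = dim_col A" "dim_col (mat_adjoint A) = dim_row A"
  by (auto simp: mat_adjoint_def)

lemma mat_adjoint_carrier [simp]: "A \<in> carrier_mat n m \<Longrightarrow> mat_adjoint A \<in> carrier_mat m n"
  by (intro carrier_matI) auto

lemma mat_adjoint_index [simp]:
  "i < dim_col A \<Longrightarrow> j < dim_row A \<Longrightarrow> mat_adjoint A $$ (i, j) = conjugate (A $$ (j, i))"
  by (auto simp: mat_adjoint_def mat_of_rows_def)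

lemma mat_adjoint_adjoint [simp]:
  "mat_adjoint (mat_adjoint A) = (A :: 'a :: conjugatable_field mat)"
  by (rule eq_matI) auto

lemma mat_adjoint_mult:
  fixes A :: "'a :: conjugatable_field mat"
  assumes "A \<in> carrier_mat n m" "B \<in> carrier_mat m k"
  shows "mat_adjoint (A * B) = mat_adjoint B * mat_adjoint A"
  using assms
  by (intro eq_matI)
    (auto simp: scalar_prod_def conjugate_dist_mul sum_conjugate mult.commute intro!: sum.cong)

text \<open>One product suffices for square matrices; \<open>unitary_matD\<close> recovers the other
  one.\<close>

definition unitary_mat :: "nat \<Rightarrow> complex mat \<Rightarrow> bool" where
  "unitary_mat n U \<longleftrightarrow> U \<in> carrier_mat n n \<and> mat_adjoint U * U = 1\<^sub>m n"

lemma unitary_matD: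
  assumes "unitary_mat n U"
  shows "U \<in> carrier_mat n n" "mat_adjoint U * U = 1\<^sub>m n" "U * mat_adjoint U = 1\<^sub>m n"
    "mat_adjoint U \<in> carrier_mat n n"
  using assms mat_mult_left_right_inverse[of "mat_adjoint U" n U] by (auto simp: unitary_mat_def)

lemma unitary_mat_adjoint: "unitary_mat n U \<Longrightarrow> unitary_mat n (mat_adjoint U)"
  by (frule unitary_matD(1), frule unitary_matD(3)) (simp add: unitary_mat_def)

lemma unitary_mat_mult:
  assumes U: "unitary_mat n U" and V: "unitary_mat n V"
  shows "unitary_mat n (U * V)"
proof -
  note u = unitary_matD[OF U] and v = unitary_matD[OF V]
  note [simp] = mult_carrier_mat[of _ n n _ n]
  have "mat_adjoint (U * V) * (U * V) = mat_adjoint V * (mat_adjoint U * U) * V"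
    using u(1) v(1) by (simp add: mat_adjoint_mult[OF u(1) v(1)] assoc_mult_mat[of _ n n _ n _ n])
  with u v show ?thesis by (simp add: unitary_mat_def)
qed

text \<open>A Householder reflection in \<open>w = u - e\<^sub>0\<close>, for a unit multiple \<open>u\<close> of \<open>v\<close> whose phase
  is chosen such that its first entry is real and nonpositive; then \<open>w\<^sup>* w = 2 (1 - u\<^sub>0) \<noteq> 0\<close>.\<close>

lemma unitary_mat_first_col:
  fixes v :: "complex vec"
  assumes v: "v \<in> carrier_vec n" "v \<noteq> 0\<^sub>v n"
  obtains U c where "unitary_mat n U" "c \<noteq> 0" "col U 0 = c \<cdot>\<^sub>v v"
proof -
  obtain i0 where i0: "i0 < n" "v $ i0 \<noteq> 0"
    using v by (metis carrier_vecD eq_vecI index_zero_vec(1) index_zero_vec(2))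
  hence n: "0 < n" by simp
  define s where "s = (\<Sum>i<n. (cmod (v $ i))\<^sup>2)"
  have "(cmod (v $ i0))\<^sup>2 \<le> s" unfolding s_def
    using i0 by (intro member_le_sum) auto
  moreover have "0 < (cmod (v $ i0))\<^sup>2" using i0 by simp
  ultimately have s: "s > 0" by linarith
  define ph where "ph = (if v $ 0 = 0 then 1 else - (cnj (v $ 0) / cmod (v $ 0)))"
  have ph: "cmod ph = 1" by (auto simp: ph_def norm_divide)
  define a where "a = ph / sqrt s"
  have "ph * v $ 0 = - of_real (cmod (v $ 0))"
  proof (cases "v $ 0 = 0")
    case False
    have "cnj (v $ 0) * v $ 0 = of_real (cmod (v $ 0)) * of_real (cmod (v $ 0))"
      using complex_norm_square[of "v $ 0"] by (simp add: power2_eq_square mult.commute)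
    thus ?thesis using False by (simp add: ph_def)
  qed simp
  hence u0: "a * v $ 0 = of_real (- (cmod (v $ 0) / sqrt s))" by (simp add: a_def)
  define r where "r = - (cmod (v $ 0) / sqrt s)"
  have r: "r \<le> 0" using s by (simp add: r_def)
  define u where "u i = a * v $ i" for i
  have u0: "u 0 = of_real r" using u0 by (simp add: u_def r_def)
  have "cmod a ^ 2 = 1 / s" using s ph by (simp add: a_def norm_divide power_divide)
  hence unorm: "(\<Sum>i<n. u i * cnj (u i)) = 1"
  proof -
    have "(\<Sum>i<n. u i * cnj (u i)) = (\<Sum>i<n. of_real ((cmod a)\<^sup>2 * (cmod (v $ i))\<^sup>2))"
      unfolding complex_norm_square[symmetric] by (simp add: u_def norm_mult power_mult_distrib)
    also have "\<dots> = of_real (\<Sum>i<n. (cmod a)\<^sup>2 * (cmod (v $ i))\<^sup>2)"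
      by simp
    also have "(\<Sum>i<n. (cmod a)\<^sup>2 * (cmod (v $ i))\<^sup>2) = 1"
      using \<open>cmod a ^ 2 = 1 / s\<close> s unfolding sum_distrib_left[symmetric] s_def[symmetric] by simp
    finally show ?thesis by simp
  qed
  define w where "w i = u i - (if i = 0 then 1 else 0)" for i
  define c :: complex where "c = of_real (1 - r)"
  have c: "c \<noteq> 0" "cnj c = c" using r by (auto simp: c_def complex_eq_iff)
  have wnorm: "(\<Sum>i<n. cnj (w i) * w i) = 2 * c"
  proof -
    have "(\<Sum>i<n. cnj (w i) * w i) = (\<Sum>i<n. u i * cnj (u i) +
        ((if i = 0 then 1 - u 0 - cnj (u 0) else 0)))"
      by (rule sum.cong) (auto simp: w_def algebra_simps)
    also have "\<dots> = 1 + (1 - u 0 - cnj (u 0))"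
      using n by (simp add: sum.distrib unorm)
    finally show ?thesis by (simp add: u0 c_def)
  qed
  define \<delta> :: "nat \<Rightarrow> nat \<Rightarrow> complex" where "\<delta> i j = (if i = j then 1 else 0)" for i j
  have \<delta>_cnj: "cnj (\<delta> i j) = \<delta> i j" for i j by (simp add: \<delta>_def)
  define U where "U = mat n n (\<lambda>(i, j). \<delta> i j - w i * cnj (w j) / c)"
  have U: "U \<in> carrier_mat n n" by (simp add: U_def)
  have "mat_adjoint U * U = 1\<^sub>m n"
  proof (rule eq_matI)
    fix i j assume "i < dim_row (1\<^sub>m n :: complex mat)" "j < dim_col (1\<^sub>m n :: complex mat)"
    hence ij: "i < n" "j < n" by auto
    have "(mat_adjoint U * U) $$ (i, j)
        = (\<Sum>k<n. cnj (\<delta> k i - w k * cnj (w i) / c) * (\<delta> k j - w k * cnj (w j) / c))"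
      using ij U by (simp add: scalar_prod_def U_def lessThan_atLeast0)
    also have "\<dots> = (\<Sum>k<n. \<delta> k i * \<delta> k j - \<delta> k i * (w k * cnj (w j) / c) - \<delta> k j * (cnj (w k) * w i / c)
          + cnj (w k) * w k * (w i * cnj (w j) / c\<^sup>2))"
      using c by (intro sum.cong refl)
        (simp add: \<delta>_cnj divide_inverse power2_eq_square algebra_simps)
    also have "\<dots> = (\<Sum>k<n. \<delta> k i * \<delta> k j) - (\<Sum>k<n. \<delta> k i * (w k * cnj (w j) / c))
        - (\<Sum>k<n. \<delta> k j * (cnj (w k) * w i / c)) + (2 * c) * (w i * cnj (w j) / c\<^sup>2)"
      unfolding sum.distrib sum_subtractf sum_distrib_right[symmetric] wnorm ..
    also have "\<dots> = \<delta> i j - w i * cnj (w j) / c - cnj (w j) * w i / c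
         + (2 * c) * (w i * cnj (w j) / c\<^sup>2)"
      using ij by (simp add: \<delta>_def if_distrib[of "\<lambda>x. x * _"] if_distrib[of "\<lambda>x. x / _"] cong: if_cong)
    also have "\<dots> = \<delta> i j" using c by (simp add: field_simps power2_eq_square)
    finally show "(mat_adjoint U * U) $$ (i, j) = 1\<^sub>m n $$ (i, j)"
      using ij by (simp add: \<delta>_def)
  qed (use U in auto)
  hence "unitary_mat n U" using U by (simp add: unitary_mat_def)
  moreover have "a \<noteq> 0" using s ph by (auto simp: a_def)
  moreover have "col U 0 = a \<cdot>\<^sub>v v"
  proof (rule eq_vecI)
    fix i assume "i < dim_vec (a \<cdot>\<^sub>v v)"
    hence i: "i < n" using v by simp
    have "cnj (w 0) = - c" by (simp add: w_def u0 c_def)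
    hence "col U 0 $ i = \<delta> i 0 + w i" using i n c by (simp add: U_def)
    thus "col U 0 $ i = (a \<cdot>\<^sub>v v) $ i" using i v by (simp add: w_def \<delta>_def u_def)
  qed (use v U in auto)
  ultimately show ?thesis by (rule that)
qed

section \<open>Spectral theorem with a prescribed order of the eigenvalues\<close>

definition diagonal_of :: "complex list \<Rightarrow> complex mat" where
  "diagonal_of es = mat (length es) (length es) (\<lambda>(i, j). if i = j then es ! i else 0)"

lemma diagonal_of_carrier [simp]: "diagonal_of es \<in> carrier_mat (length es) (length es)"
  by (simp add: diagonal_of_def)

text \<open>Deflation: a unitary matrix whose first column is an eigenvector for the head of
  \<open>es\<close> splits off a block of order 1, and the induction continues on a Hermitian block
  whose roots are the tail. Fixing the list \<open>es\<close> in advance lets two matrices with the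
  same characteristic polynomial share one diagonal matrix.\<close>

theorem hermitian_unitarily_diagonalizable:
  fixes A :: "complex mat"
  assumes "A \<in> carrier_mat n n" "mat_adjoint A = A"
    and "char_poly A = (\<Prod>e\<leftarrow>es. [:- e, 1:])" "length es = n"
  shows "\<exists>U. unitary_mat n U \<and> A = U * diagonal_of es * mat_adjoint U"
  using assms
proof (induction es arbitrary: n A)
  case Nil
  have "A = 1\<^sub>m n * diagonal_of [] * mat_adjoint (1\<^sub>m n)"
    using Nil by (intro eq_matI) auto
  moreover have "unitary_mat n (1\<^sub>m n)" using Nil by (auto simp: unitary_mat_def intro!: eq_matI)
  ultimately show ?case by blast
next
  case (Cons e es)
  define k where "k = length es"
  have n: "n = Suc k" using Cons.prems by (simp add: k_def)
  note A = Cons.prems(1)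
  have "poly (char_poly A) e = 0" using Cons.prems by simp
  then obtain v where v: "v \<in> carrier_vec n" "v \<noteq> 0\<^sub>v n" "A *\<^sub>v v = e \<cdot>\<^sub>v v"
    using eigenvalue_root_char_poly[OF A, of e] A unfolding eigenvalue_def eigenvector_def by auto
  obtain U c where U: "unitary_mat n U" and c: "c \<noteq> 0" and U0: "col U 0 = c \<cdot>\<^sub>v v"
    using unitary_mat_first_col[OF v(1,2)] by metis
  note u = unitary_matD[OF U]
  note [simp] = mult_carrier_mat[of _ n n _ n]
  define B where "B = mat_adjoint U * A * U"
  have B: "B \<in> carrier_mat n n" using A u by (simp add: B_def)
  have AB: "A = U * B * mat_adjoint U"
  proof -
    have "U * B * mat_adjoint U = (U * mat_adjoint U) * A * (U * mat_adjoint U)"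
      using u(1) A by (simp add: B_def assoc_mult_mat[of _ n n _ n _ n])
    thus ?thesis using u A by simp
  qed
  have Bh: "mat_adjoint B = B"
    using u(1) A Cons.prems(2)
    by (simp add: B_def mat_adjoint_mult[of _ n n _ n] assoc_mult_mat[of _ n n _ n _ n])
  \<comment> \<open>The first column of \<open>U\<close> is an eigenvector of \<open>A\<close>, and
    the adjoint of \<open>U\<close> maps this column to the first unit vector.\<close>
  have col0: "col B 0 = e \<cdot>\<^sub>v unit_vec n 0"
  proof -
    have 1: "col (1\<^sub>m n) 0 = mat_adjoint U *\<^sub>v col U 0"
      using col_mult2[OF u(4,1), of 0] u(2) n by simp
    have "col B 0 = mat_adjoint U *\<^sub>v (A *\<^sub>v col U 0)"
    proof -
      have "B = mat_adjoint U * (A * U)" using u A by (simp add: B_def assoc_mult_mat[of _ n n _ n _ n])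
      hence "col B 0 = mat_adjoint U *\<^sub>v col (A * U) 0"
        using col_mult2[OF u(4) mult_carrier_mat[OF A u(1)], of 0] n by simp
      also have "col (A * U) 0 = A *\<^sub>v col U 0"
        by (rule col_mult2[OF A u(1)]) (simp add: n)
      finally show ?thesis .
    qed
    also have "A *\<^sub>v col U 0 = e \<cdot>\<^sub>v col U 0"
      using A v by (simp add: U0 mult_mat_vec[of _ n n] smult_smult_assoc mult.commute)
    also have "mat_adjoint U *\<^sub>v (e \<cdot>\<^sub>v col U 0) = e \<cdot>\<^sub>v (mat_adjoint U *\<^sub>v col U 0)"
      using u n by (intro mult_mat_vec[of _ n n] col_carrier_vec) auto
    finally show ?thesis using 1 n by simp
  qed
  \<comment> \<open>As \<open>B\<close> is Hermitian, its first column determines its first row, so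
    \<open>B\<close> is block diagonal.\<close>
  have B0: "B $$ (i, 0) = (if i = 0 then e else 0)" "B $$ (0, i) = (if i = 0 then cnj e else 0)"
    if "i < n" for i
  proof -
    have "col B 0 $ i = B $$ (i, 0)" using that B n by simp
    thus 1: "B $$ (i, 0) = (if i = 0 then e else 0)" 
      using col0 that n by (cases "i = 0") simp_all
    have "B $$ (0, i) = cnj (B $$ (i, 0))"
      using mat_adjoint_index[of 0 B i] that B n Bh by simp
    thus "B $$ (0, i) = (if i = 0 then cnj e else 0)" using 1 by simp
  qed
  \<comment> \<open>The two descriptions of the corner entry show that the eigenvalue is
    real.\<close>
  have e: "cnj e = e" using B0[of 0] n by simp
  define C where "C = mat k k (\<lambda>(i, j). B $$ (Suc i, Suc j))"
  have C: "C \<in> carrier_mat k k" by (simp add: C_def)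
  define E where "E = mat 1 1 (\<lambda>_::nat\<times>nat. e)"
  have E: "E \<in> carrier_mat 1 1" by (simp add: E_def)
  have BC: "B = four_block_mat E (0\<^sub>m 1 k) (0\<^sub>m k 1) C"
    by (rule eq_matI) (use B n B0 e in \<open>auto simp: E_def C_def\<close>)
  have Ch: "mat_adjoint C = C"
  proof (rule eq_matI)
    fix i j assume "i < dim_row C" "j < dim_col C"
    hence ij: "i < k" "j < k" by (auto simp: C_def)
    have "B $$ (Suc i, Suc j) = cnj (B $$ (Suc j, Suc i))"
      using mat_adjoint_index[of "Suc i" B "Suc j"] ij B n Bh by simp
    thus "mat_adjoint C $$ (i, j) = C $$ (i, j)" using ij by (simp add: C_def)
  qed (auto simp: C_def)
  have "similar_mat A B"
    using A B u AB by (intro similar_matI[of A B U "mat_adjoint U" n]) auto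
  hence "char_poly A = char_poly E * char_poly C"
    using char_poly_four_block_zeros_col[OF E zero_carrier_mat[of 1 k] C] BC char_poly_similar by metis
  also have "char_poly E = [:- e, 1:]"
    using char_poly_upper_triangular[OF E] by (simp add: E_def diag_mat_def upper_triangular_def)
  finally have "char_poly C = (\<Prod>e\<leftarrow>es. [:- e, 1:])"
    using Cons.prems(3) by (simp del: mult_pCons_left)
  from Cons.IH[OF C Ch this] obtain V where V: "unitary_mat k V"
      and CV: "C = V * diagonal_of es * mat_adjoint V" by (auto simp: k_def)
  note v' = unitary_matD[OF V]
  \<comment> \<open>Extending \<open>V\<close> by an entry 1 turns the diagonalization of
    \<open>C\<close> into one of \<open>B\<close>.\<close>
  define W where "W = four_block_mat (1\<^sub>m 1) (0\<^sub>m 1 k) (0\<^sub>m k 1) V"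
  have W: "W \<in> carrier_mat n n" using v' n by (auto simp: W_def)
  have Wa: "mat_adjoint W = four_block_mat (1\<^sub>m 1) (0\<^sub>m 1 k) (0\<^sub>m k 1) (mat_adjoint V)"
    by (rule eq_matI) (use v' in \<open>auto simp: W_def\<close>)
  have Ve: "diagonal_of es \<in> carrier_mat k k" by (simp add: k_def)
  have D: "diagonal_of (e # es) = four_block_mat E (0\<^sub>m 1 k) (0\<^sub>m k 1) (diagonal_of es)"
    by (rule eq_matI) (auto simp: diagonal_of_def E_def k_def nth_Cons')
  have "mat_adjoint W * W = 1\<^sub>m n"
    unfolding Wa unfolding W_def
    using v' n by (subst mult_four_block_mat[of _ 1 1 _ k _ k _ _ 1 _ k]) auto
  hence WU: "unitary_mat n W" using W by (simp add: unitary_mat_def)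
  have "W * diagonal_of (e # es) * mat_adjoint W = B"
    unfolding Wa D BC CV unfolding W_def
    using v' Ve E
    apply (subst mult_four_block_mat[of _ 1 1 _ k _ k _ _ 1 _ k], auto)
    apply (subst mult_four_block_mat[of _ 1 1 _ k _ k _ _ 1 _ k], auto)
    done
  moreover have "diagonal_of (e # es) \<in> carrier_mat n n" using n by (metis diagonal_of_carrier Cons.prems(4))
  ultimately have "A = (U * W) * diagonal_of (e # es) * mat_adjoint (U * W)"
    by (subst AB, elim subst[of _ B])
      (use u W in \<open>simp add: mat_adjoint_mult[of _ n n _ n] assoc_mult_mat[of _ n n _ n _ n]\<close>)
  with unitary_mat_mult[OF U WU] show ?case by blast
qed

text \<open>Both matrices are unitarily similar to one diagonal matrix that lists the common roots
  in the same order; the two unitaries compose to \<open>U\<close>.\<close>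

theorem hermitian_unitarily_similar:
  fixes A B :: "complex mat"
  assumes "A \<in> carrier_mat n n" "mat_adjoint A = A"
    and "B \<in> carrier_mat n n" "mat_adjoint B = B"
    and "char_poly A = char_poly B"
  obtains U where "unitary_mat n U" "A = U * B * mat_adjoint U"
proof -
  obtain es where es: "char_poly A = (\<Prod>e\<leftarrow>es. [:- e, 1:])" "length es = n"
    using char_poly_factorized[OF assms(1)] by blast
  let ?D = "diagonal_of es"
  have D: "?D \<in> carrier_mat n n" using es(2) by (metis diagonal_of_carrier)
  obtain U where U: "unitary_mat n U" "A = U * ?D * mat_adjoint U"
    using hermitian_unitarily_diagonalizable[OF assms(1,2) es] by blast
  obtain V where V: "unitary_mat n V" "B = V * ?D * mat_adjoint V"
    using hermitian_unitarily_diagonalizable[OF assms(3,4)] es assms(5) by metis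
  note u = unitary_matD[OF U(1)] and v = unitary_matD[OF V(1)]
  note [simp] = mult_carrier_mat[of _ n n _ n]
  have "(U * mat_adjoint V) * B * mat_adjoint (U * mat_adjoint V)
      = U * ((mat_adjoint V * V) * ?D * (mat_adjoint V * V)) * mat_adjoint U"
    unfolding V(2) using u(1,4) v(1,4) D
    by (simp add: mat_adjoint_mult[of _ n n _ n] assoc_mult_mat[of _ n n _ n _ n])
  also have "\<dots> = A" using v D U(2) by simp
  finally show ?thesis
    using that[of "U * mat_adjoint V"] U V unitary_mat_mult unitary_mat_adjoint by metis
qed

section \<open>The matrix equation \<open>A * Z + Z * B = 0\<close>\<close>

text \<open>In eigenbases, \<open>A\<close> and \<open>B\<close> become the same diagonal matrix
  with entries e_i, and the equation reads (e_i + e_j) w_ij = 0 entrywise, while no two eigenvalues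
  sum to zero. Two matrices instead of one cover the pair of a matrix and its transpose.\<close>

lemma hermitian_anticommuting_eq_0:
  fixes A B Z :: "complex mat"
  assumes A: "A \<in> carrier_mat n n" "mat_adjoint A = A"
    and B: "B \<in> carrier_mat n n" "mat_adjoint B = B"
    and AB: "char_poly A = char_poly B"
    and ev: "\<And>x. eigenvalue A x \<Longrightarrow> \<not> eigenvalue A (- x)"
    and Z: "Z \<in> carrier_mat n n" "A * Z + Z * B = 0\<^sub>m n n"
  shows "Z = 0\<^sub>m n n"
proof -
  obtain es where es: "char_poly A = (\<Prod>e\<leftarrow>es. [:- e, 1:])" "length es = n"
    using char_poly_factorized[OF A(1)] by blast
  let ?D = "diagonal_of es"
  have D: "?D \<in> carrier_mat n n" using es(2) by (metis diagonal_of_carrier)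
  obtain U where U: "unitary_mat n U" "A = U * ?D * mat_adjoint U"
    using hermitian_unitarily_diagonalizable[OF A es] by blast
  obtain V where V: "unitary_mat n V" "B = V * ?D * mat_adjoint V"
    using hermitian_unitarily_diagonalizable[OF B] es AB by metis
  note u = unitary_matD[OF U(1)] and v = unitary_matD[OF V(1)]
  note [simp] = mult_carrier_mat[of _ n n _ n]
  note [simp] = assoc_mult_mat[of _ n n _ n _ n]
  define W where "W = mat_adjoint U * Z * V"
  have W: "W \<in> carrier_mat n n" using u v Z by (simp add: W_def)
  have "mat_adjoint U * (A * Z + Z * B) * V = mat_adjoint U * A * Z * V + mat_adjoint U * Z * B * V"
    using u(1,4) v(1,4) A(1) B(1) Z(1)
    by (simp add: mult_add_distrib_mat[of _ n n _ n] add_mult_distrib_mat[of _ n n _ _ n])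
  also have "mat_adjoint U * A * Z * V = (mat_adjoint U * U) * ?D * W"
    unfolding U(2) W_def using u(1,4) v(1,4) D Z(1) by simp
  also have "\<dots> = ?D * W" using u D by simp
  also have "mat_adjoint U * Z * B * V = W * ?D * (mat_adjoint V * V)"
    unfolding V(2) W_def using u(1,4) v(1,4) D Z(1) by simp
  also have "\<dots> = W * ?D" using v D W by simp
  finally have 0: "?D * W + W * ?D = 0\<^sub>m n n" using Z(2) u(1,4) v(1) by simp
  have "W = 0\<^sub>m n n"
  proof (rule eq_matI)
    fix i j assume "i < dim_row (0\<^sub>m n n :: complex mat)" "j < dim_col (0\<^sub>m n n :: complex mat)"
    hence ij: "i < n" "j < n" by auto
    have "(?D * W + W * ?D) $$ (i, j) = (es ! i) * W $$ (i, j) + W $$ (i, j) * (es ! j)"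
      using ij W D es(2)
      by (simp add: scalar_prod_def diagonal_of_def if_distrib[of "\<lambda>x. x * _"]
          if_distrib[of "\<lambda>x. _ * x"] cong: if_cong)
    hence "(es ! i + es ! j) * W $$ (i, j) = 0"
      using 0 ij by (simp add: algebra_simps)
    moreover have "eigenvalue A (es ! l)" if "l < n" for l
      using that es unfolding eigenvalue_root_char_poly[OF A(1)]
      by (auto simp: poly_prod_list prod_list_zero_iff image_iff in_set_conv_nth intro!: exI[of _ l])
    with ev ij have "es ! i + es ! j \<noteq> 0" by (metis add_eq_0_iff)
    ultimately show "W $$ (i, j) = 0\<^sub>m n n $$ (i, j)" using ij by simp
  qed (use W in auto)
  hence "U * W * mat_adjoint V = 0\<^sub>m n n" using u v by simp
  moreover have "U * W * mat_adjoint V = (U * mat_adjoint U) * Z * (V * mat_adjoint V)"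
    unfolding W_def using u(1,4) v(1,4) Z(1) by simp
  ultimately show ?thesis using u v Z by simp
qed

section \<open>Inner product and trace\<close>

lemma mult_mat_vec_cscalar_adjoint:
  fixes A :: "complex mat"
  assumes "A \<in> carrier_mat n m" "v \<in> carrier_vec m" "w \<in> carrier_vec n"
  shows "(A *\<^sub>v v) \<bullet>c w = v \<bullet>c (mat_adjoint A *\<^sub>v w)"
proof -
  have "(A *\<^sub>v v) \<bullet>c w = (\<Sum>i<n. \<Sum>j<m. A $$ (i, j) * v $ j * cnj (w $ i))"
    using assms by (simp add: scalar_prod_def lessThan_atLeast0 sum_distrib_right)
  also have "\<dots> = (\<Sum>j<m. \<Sum>i<n. A $$ (i, j) * v $ j * cnj (w $ i))"
    by (rule sum.swap)
  also have "\<dots> = v \<bullet>c (mat_adjoint A *\<^sub>v w)"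
    using assms by (simp add: scalar_prod_def lessThan_atLeast0 sum_distrib_left mult_ac)
  finally show ?thesis .
qed

text \<open>Cyclicity of the trace; it makes the trace of a square invariant under unitary
  similarity.\<close>

lemma sum_diag_mult_commute:
  fixes A B :: "'a :: comm_semiring_0 mat"
  assumes "A \<in> carrier_mat n m" "B \<in> carrier_mat m n"
  shows "(\<Sum>i<n. (A * B) $$ (i, i)) = (\<Sum>i<m. (B * A) $$ (i, i))"
proof -
  have "(\<Sum>i<n. (A * B) $$ (i, i)) = (\<Sum>i<n. \<Sum>j<m. A $$ (i, j) * B $$ (j, i))"
    using assms by (simp add: scalar_prod_def lessThan_atLeast0)
  also have "\<dots> = (\<Sum>j<m. \<Sum>i<n. A $$ (i, j) * B $$ (j, i))" by (rule sum.swap)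
  also have "\<dots> = (\<Sum>i<m. (B * A) $$ (i, i))"
    using assms by (simp add: scalar_prod_def lessThan_atLeast0 mult.commute)
  finally show ?thesis .
qed

section \<open>Adjacency matrices of cycles\<close>

definition cycle_adj :: "nat \<Rightarrow> nat \<Rightarrow> nat \<Rightarrow> complex" where
  "cycle_adj m i j = (if j = Suc i mod m \<or> i = Suc j mod m then 1 else 0)"

definition cycle_mat :: "nat \<Rightarrow> complex mat" where
  "cycle_mat m = mat m m (\<lambda>(i, j). cycle_adj m i j)"

lemma cycle_mat_carrier [simp]: "cycle_mat m \<in> carrier_mat m m"
  by (simp add: cycle_mat_def)

lemma cycle_mat_hermitian: "mat_adjoint (cycle_mat m) = cycle_mat m"
  by (rule eq_matI) (auto simp: cycle_mat_def cycle_adj_def)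

lemma bij_betw_Suc_mod: "bij_betw (\<lambda>i. Suc i mod m) {..<m} {..<m}"
proof (cases "m = 0")
  case False
  have inj: "inj_on (\<lambda>i. Suc i mod m) {..<m}"
    by (rule inj_onI) (auto simp: mod_Suc split: if_splits)
  have "(\<lambda>i. Suc i mod m) ` {..<m} \<subseteq> {..<m}" using False by auto
  with inj show ?thesis by (simp add: bij_betw_def endo_inj_surj)
qed simp

lemma sum_cycle_adj:
  assumes "m \<ge> 3" "i < m"
  shows "(\<Sum>j<m. cycle_adj m i j * y j) = y (Suc i mod m) + y ((i + m - 1) mod m)"
proof -
  have 1: "i = Suc j mod m \<longleftrightarrow> j = (i + m - 1) mod m" if "j < m" for j
    using assms that by (auto simp: mod_Suc mod_if split: if_splits)
  \<comment> \<open>For m at least 3 the two neighbours differ, so the indicator of being a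
    neighbour is a sum of two indicators.\<close>
  have 2: "Suc i mod m \<noteq> (i + m - 1) mod m"
    using assms by (auto simp: mod_Suc mod_if)
  have "(\<Sum>j<m. cycle_adj m i j * y j)
      = (\<Sum>j<m. (if j = Suc i mod m then y j else 0) + (if j = (i + m - 1) mod m then y j else 0))"
    using 1 2 by (intro sum.cong) (auto simp: cycle_adj_def)
  also have "\<dots> = y (Suc i mod m) + y ((i + m - 1) mod m)"
    using assms by (simp add: sum.distrib)
  finally show ?thesis .
qed

lemma cycle_mat_mult_vec:
  assumes "m \<ge> 3" "y \<in> carrier_vec m" "i < m"
  shows "(cycle_mat m *\<^sub>v y) $ i = y $ (Suc i mod m) + y $ ((i + m - 1) mod m)"
  using sum_cycle_adj[OF assms(1,3), of "\<lambda>j. y $ j"] assms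
  by (simp add: cycle_mat_def scalar_prod_def lessThan_atLeast0)

section \<open>The quadratic form of the cycle\<close>

lemma cycle_mat_form:
  assumes "m \<ge> 3" "y \<in> carrier_vec m"
  shows "(cycle_mat m *\<^sub>v y) \<bullet>c y
    = (\<Sum>i<m. y $ (Suc i mod m) * cnj (y $ i)) + (\<Sum>i<m. y $ i * cnj (y $ (Suc i mod m)))"
proof -
  have "(cycle_mat m *\<^sub>v y) \<bullet>c y
      = (\<Sum>i<m. (y $ (Suc i mod m) + y $ ((i + m - 1) mod m)) * cnj (y $ i))"
    using assms by (simp add: scalar_prod_def lessThan_atLeast0 cycle_mat_mult_vec)
  also have "\<dots> = (\<Sum>i<m. y $ (Suc i mod m) * cnj (y $ i))
      + (\<Sum>i<m. y $ ((i + m - 1) mod m) * cnj (y $ i))"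
    by (simp add: ring_distribs sum.distrib)
  also have "(\<Sum>i<m. y $ ((i + m - 1) mod m) * cnj (y $ i))
      = (\<Sum>i<m. y $ ((Suc i mod m + m - 1) mod m) * cnj (y $ (Suc i mod m)))"
    by (rule sum.reindex_bij_betw[OF bij_betw_Suc_mod, symmetric])
  also have "\<dots> = (\<Sum>i<m. y $ i * cnj (y $ (Suc i mod m)))"
  proof (rule sum.cong)
    fix i assume "i \<in> {..<m}"
    hence "(Suc i mod m + m - 1) mod m = i" using assms by (auto simp: mod_Suc mod_if)
    thus "y $ ((Suc i mod m + m - 1) mod m) * cnj (y $ (Suc i mod m)) = y $ i * cnj (y $ (Suc i mod m))"
      by simp
  qed simp
  finally show ?thesis .
qed

text \<open>The sum of |y_(i+1) - \<epsilon> y_i|^2 equals 2 y* y - \<epsilon> y* A y, with A the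
  matrix of the cycle. Under the hypothesis it is 0, since \<epsilon>^2 = 1, so each term
  vanishes.\<close>

lemma cycle_mat_form_diff:
  fixes \<epsilon> :: complex
  assumes "m \<ge> 3" "y \<in> carrier_vec m" and \<epsilon>: "\<epsilon> = 1 \<or> \<epsilon> = - 1"
    and eq: "(cycle_mat m *\<^sub>v y) \<bullet>c y = 2 * \<epsilon> * (y \<bullet>c y)" and "i < m"
  shows "y $ (Suc i mod m) = \<epsilon> * y $ i"
proof -
  let ?s = "\<lambda>i. Suc i mod m"
  have n: "y \<bullet>c y = (\<Sum>i<m. y $ i * cnj (y $ i))"
    using assms by (simp add: scalar_prod_def lessThan_atLeast0)
  have n': "y \<bullet>c y = (\<Sum>i<m. y $ ?s i * cnj (y $ ?s i))"
    unfolding n by (rule sum.reindex_bij_betw[OF bij_betw_Suc_mod, symmetric])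
  have "complex_of_real (\<Sum>i<m. (cmod (y $ ?s i - \<epsilon> * y $ i))\<^sup>2)
      = (\<Sum>i<m. (y $ ?s i - \<epsilon> * y $ i) * cnj (y $ ?s i - \<epsilon> * y $ i))"
    unfolding of_real_sum complex_norm_square ..
  also have "\<dots> = (\<Sum>i<m. y $ ?s i * cnj (y $ ?s i) + y $ i * cnj (y $ i)
      - \<epsilon> * (y $ ?s i * cnj (y $ i) + y $ i * cnj (y $ ?s i)))"
    using \<epsilon> by (intro sum.cong) (auto simp: algebra_simps)
  also have "\<dots> = y \<bullet>c y + y \<bullet>c y - \<epsilon> * ((cycle_mat m *\<^sub>v y) \<bullet>c y)"
    unfolding cycle_mat_form[OF assms(1,2)] sum_subtractf sum_distrib_left[symmetric] sum.distrib
    by (simp add: n[symmetric] n'[symmetric])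
  also have "\<dots> = 0" unfolding eq using \<epsilon> by auto
  finally have "(\<Sum>i<m. (cmod (y $ ?s i - \<epsilon> * y $ i))\<^sup>2) = 0" by (simp only: of_real_eq_0_iff)
  hence "(cmod (y $ ?s i - \<epsilon> * y $ i))\<^sup>2 = 0"
    using \<open>i < m\<close> by (subst (asm) sum_nonneg_eq_0_iff) auto
  thus ?thesis by simp
qed

text \<open>The index k may exceed m: at k = m the relation closes up to y_0 = c^m y_0.\<close>

lemma cyclic_iterate:
  fixes y :: "complex vec"
  assumes "\<And>i. i < m \<Longrightarrow> y $ (Suc i mod m) = c * y $ i" "m > 0"
  shows "y $ (k mod m) = c ^ k * y $ 0"
proof (induction k)
  case (Suc k)
  have "Suc k mod m = Suc (k mod m) mod m" by (simp add: mod_Suc_eq)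
  thus ?case using assms(1)[of "k mod m"] assms(2) Suc by simp
qed simp

section \<open>Eigenvalues of the cycle\<close>

text \<open>An eigenvector, read periodically, satisfies Y(k+2) = x Y(k+1) - Y(k), a recurrence with
  characteristic roots \<mu> and 1/\<mu>. Periodicity makes one of them, hence both, an m-th root of
  unity.\<close>

lemma cycle_mat_eigenvalue:
  assumes "m \<ge> 3" "eigenvalue (cycle_mat m) x"
  obtains \<mu> where "\<mu> ^ m = 1" "x = \<mu> + inverse \<mu>" "\<mu> \<noteq> 0"
proof -
  obtain y where y: "y \<in> carrier_vec m" "y \<noteq> 0\<^sub>v m" "cycle_mat m *\<^sub>v y = x \<cdot>\<^sub>v y"
    using assms(2) by (auto simp: eigenvalue_def eigenvector_def cycle_mat_def)
  \<comment> \<open>A root of t^2 - x t + 1, so that x = \<mu> + 1/\<mu>.\<close>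
  define \<mu> where "\<mu> = (x + csqrt (x\<^sup>2 - 4)) / 2"
  have "\<mu>\<^sup>2 - x * \<mu> + 1 = 0"
  proof -
    have "4 * (\<mu>\<^sup>2 - x * \<mu> + 1) = (csqrt (x\<^sup>2 - 4))\<^sup>2 - (x\<^sup>2 - 4)"
      unfolding \<mu>_def by (simp add: field_simps power2_eq_square del: power2_csqrt)
    hence "4 * (\<mu>\<^sup>2 - x * \<mu> + 1) = 0" by (simp only: power2_csqrt diff_self)
    thus ?thesis by (simp only: mult_eq_0_iff) simp
  qed
  hence mu: "\<mu> * (x - \<mu>) = 1" by (simp add: power2_eq_square algebra_simps)
  hence \<mu>0: "\<mu> \<noteq> 0" by auto
  hence x: "x = \<mu> + inverse \<mu>" using mu by (simp add: field_simps)
  define Y where "Y k = y $ (k mod m)" for k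
  have per: "Y (k + m) = Y k" for k by (simp add: Y_def)
  have rec: "Y (Suc (Suc k)) = x * Y (Suc k) - Y k" for k
  proof -
    let ?i = "Suc k mod m"
    have i: "?i < m" using assms(1) by simp
    have "(?i + m - 1) mod m = k mod m"
      using assms(1) by (cases "Suc (k mod m) = m") (auto simp: mod_Suc)
    moreover have "Suc ?i mod m = Suc (Suc k) mod m" by (simp add: mod_Suc_eq)
    ultimately have "x * y $ ?i = y $ (Suc (Suc k) mod m) + y $ (k mod m)"
      using cycle_mat_mult_vec[OF assms(1) y(1) i] i y(1,3) by simp
    thus ?thesis by (simp add: Y_def)
  qed
  \<comment> \<open>Splitting off the factor for \<mu> leaves a geometric sequence with ratio
    1/\<mu>. If it is nonzero, its period gives the root of unity; otherwise \<open>Y\<close> itself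
    is geometric with ratio \<mu>.\<close>
  define u where "u k = Y (Suc k) - \<mu> * Y k" for k
  have "u (Suc k) = inverse \<mu> * u k" for k
    unfolding u_def rec x using \<mu>0 by (simp add: field_simps)
  hence uk: "u k = inverse \<mu> ^ k * u 0" for k by (induction k) simp_all
  have um: "u m = u 0" using per[of 0] per[of 1] by (simp add: u_def)
  have "\<mu> ^ m = 1"
  proof (cases "u 0 = 0")
    case False
    hence "inverse \<mu> ^ m = 1" using uk[of m] um by simp
    thus ?thesis using \<mu>0 by (simp add: power_inverse)
  next
    case True
    hence "Y (Suc k) = \<mu> * Y k" for k using uk[of k] by (simp add: u_def)
    hence Yk: "Y k = \<mu> ^ k * Y 0" for k by (induction k) simp_all
    have "Y 0 \<noteq> 0"
    proof
      assume "Y 0 = 0"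
      hence "y $ i = 0" if "i < m" for i using Yk[of i] that by (simp add: Y_def)
      hence "y = 0\<^sub>v m" using y(1) by auto
      thus False using y(2) by simp
    qed
    thus ?thesis using Yk[of m] per[of 0] by simp
  qed
  thus ?thesis using that x \<mu>0 by blast
qed

text \<open>If \<open>\<mu> + 1/\<mu> = - (\<nu> + 1/\<nu>)\<close> then \<open>\<nu> = - \<mu>\<close> or \<open>\<mu> \<nu> = - 1\<close>,
  and neither is possible for \<open>m\<close>-th roots of unity with \<open>m\<close> odd.\<close>

lemma odd_cycle_mat_eigenvalue_uminus:
  assumes "odd m" "m \<ge> 3" "eigenvalue (cycle_mat m) x"
  shows "\<not> eigenvalue (cycle_mat m) (- x)"
proof
  assume "eigenvalue (cycle_mat m) (- x)"
  then obtain \<nu> where \<nu>: "\<nu> ^ m = 1" "- x = \<nu> + inverse \<nu>" "\<nu> \<noteq> 0"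
    using cycle_mat_eigenvalue assms(2) by metis
  obtain \<mu> where \<mu>: "\<mu> ^ m = 1" "x = \<mu> + inverse \<mu>" "\<mu> \<noteq> 0"
    using cycle_mat_eigenvalue assms(2,3) by metis
  have "(\<mu> + \<nu>) * (\<mu> * \<nu> + 1) = \<mu> * \<nu> * ((\<mu> + inverse \<mu>) + (\<nu> + inverse \<nu>))"
    using \<mu>(3) \<nu>(3) by (simp add: field_simps)
  also have "(\<mu> + inverse \<mu>) + (\<nu> + inverse \<nu>) = 0"
    unfolding \<mu>(2)[symmetric] \<nu>(2)[symmetric] by simp
  finally have "\<mu> + \<nu> = 0 \<or> \<mu> * \<nu> + 1 = 0" by simp
  then consider "\<nu> = - \<mu>" | "\<mu> * \<nu> = - 1"
    by (auto simp: add_eq_0_iff minus_equation_iff)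
  thus False
  proof cases
    case 1
    thus ?thesis using \<mu>(1) \<nu>(1) assms(1) by (simp add: power_minus_odd)
  next
    case 2
    have "(\<mu> * \<nu>) ^ m = 1" using \<mu>(1) \<nu>(1) by (simp add: power_mult_distrib)
    thus ?thesis using assms(1) by (simp add: 2)
  qed
qed

section \<open>Hermitian matrices cospectral with an odd cycle\<close>

locale cospectral_cycle =
  fixes m :: nat and H :: "complex mat"
  assumes odd_m: "odd m" and m3: "m \<ge> 3"
    and H: "H \<in> carrier_mat m m" "mat_adjoint H = H"
    and char_poly_eq: "char_poly H = char_poly (cycle_mat m)"
begin

text \<open>The trace of the square is invariant under unitary similarity, and the diagonal entries
  of the square of the cycle matrix are the degrees 2. When all entries are 0 or of modulus 1, this
  counts the ordered adjacent pairs.\<close>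

lemma sum_norm_entries: "(\<Sum>i<m. \<Sum>j<m. H $$ (i, j) * H $$ (j, i)) = of_nat (2 * m)"
proof -
  have diag: "(\<Sum>i<m. \<Sum>j<m. X $$ (i, j) * X $$ (j, i)) = (\<Sum>i<m. (X * X) $$ (i, i))"
    if "X \<in> carrier_mat m m" for X :: "complex mat"
    using that by (simp add: scalar_prod_def lessThan_atLeast0)
  let ?A = "cycle_mat m"
  obtain U where U: "unitary_mat m U" "H = U * ?A * mat_adjoint U"
    using hermitian_unitarily_similar[OF H cycle_mat_carrier cycle_mat_hermitian char_poly_eq] by metis
  note u = unitary_matD[OF U(1)]
  note [simp] = mult_carrier_mat[of _ m m _ m] assoc_mult_mat[of _ m m _ m _ m]
  have "H * H = U * ?A * (mat_adjoint U * U) * ?A * mat_adjoint U"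
    unfolding U(2) using u(1,4) by simp
  also have "\<dots> = (U * (?A * ?A)) * mat_adjoint U" using u by (simp add: left_mult_one_mat[of _ m m])
  finally have "(\<Sum>i<m. (H * H) $$ (i, i)) = (\<Sum>i<m. (mat_adjoint U * (U * (?A * ?A))) $$ (i, i))"
    using u by (simp only:) (rule sum_diag_mult_commute, auto)
  also have "mat_adjoint U * (U * (?A * ?A)) = (mat_adjoint U * U) * (?A * ?A)"
    using u(1,4) by simp
  also have "\<dots> = ?A * ?A" using u by (simp add: left_mult_one_mat[of _ m m])
  also have "(\<Sum>i<m. (?A * ?A) $$ (i, i)) = (\<Sum>i<m. \<Sum>j<m. cycle_adj m i j * cycle_adj m j i)"
    unfolding diag[OF cycle_mat_carrier, symmetric] by (simp add: cycle_mat_def)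
  also have "\<dots> = (\<Sum>i<m. 2)"
  proof (rule sum.cong)
    fix i assume "i \<in> {..<m}"
    hence "(\<Sum>j<m. cycle_adj m i j * 1) = 2" using sum_cycle_adj[OF m3, of i "\<lambda>_. 1"] by simp
    thus "(\<Sum>j<m. cycle_adj m i j * cycle_adj m j i) = 2"
      by (subst (asm) sum.cong[OF refl, of _ _ "\<lambda>j. cycle_adj m i j * cycle_adj m j i"])
        (auto simp: cycle_adj_def)
  qed simp
  finally show ?thesis using diag[OF H(1)] by simp
qed

section \<open>Trivial kernels of the incidence matrices\<close>

text \<open>The hypothesis on \<open>z\<close> is the equation H Z + Z K = 0 for the diagonal matrix
  Z with entries \<open>z\<close>, and no eigenvalue of \<open>H\<close> is the negative of an
  eigenvalue.\<close>

lemma anticommuting_eq_0: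
  assumes K: "K \<in> carrier_mat m m" "mat_adjoint K = K" "char_poly K = char_poly H"
    and z: "\<And>i j. i < m \<Longrightarrow> j < m \<Longrightarrow> H $$ (i, j) * z j + z i * K $$ (i, j) = 0" and "i < m"
  shows "z i = 0"
proof -
  define Z where "Z = mat m m (\<lambda>(i, j). if i = j then z i else 0)"
  have Z: "Z \<in> carrier_mat m m" by (simp add: Z_def)
  have "H * Z + Z * K = 0\<^sub>m m m"
    using z K H Z
    by (intro eq_matI) (auto simp: Z_def scalar_prod_def if_distrib[of "\<lambda>x. x * _"]
          if_distrib[of "\<lambda>x. _ * x"] cong: if_cong)
  moreover have "\<not> eigenvalue H (- x)" if "eigenvalue H x" for x
    using odd_cycle_mat_eigenvalue_uminus[OF odd_m m3] that
    unfolding eigenvalue_root_char_poly[OF H(1)] char_poly_eq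
      eigenvalue_root_char_poly[OF cycle_mat_carrier, symmetric] .
  ultimately have "Z = 0\<^sub>m m m"
    using hermitian_anticommuting_eq_0[OF H K(1,2) K(3)[symmetric]] Z by metis
  hence "Z $$ (i, i) = 0" using \<open>i < m\<close> by simp
  thus ?thesis using \<open>i < m\<close> by (simp add: Z_def)
qed

text \<open>The case K = H: the hypothesis on adjacent pairs places \<open>z\<close> in the kernel
  of the signless incidence matrix.\<close>

lemma signless_injective:
  fixes z :: "nat \<Rightarrow> complex"
  assumes "\<And>i j. i < m \<Longrightarrow> j < m \<Longrightarrow> H $$ (i, j) \<noteq> 0 \<Longrightarrow> z i + z j = 0" "i < m"
  shows "z i = 0"
proof (rule anticommuting_eq_0[OF H refl, of z])
  fix i j assume "i < m" "j < m"
  thus "H $$ (i, j) * z j + z i * H $$ (i, j) = 0"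
    using assms(1)[of i j] by (cases "H $$ (i, j) = 0") (auto simp: add_eq_0_iff)
qed (rule assms(2))

text \<open>Here \<open>diag z\<close> intertwines \<open>H\<close> and \<open>- H\<^sup>T\<close>: for \<open>|h| = 1\<close> the condition
  reads \<open>z\<^sub>i + h\<^sup>2 z\<^sub>j = 0\<close>.\<close>

lemma twisted_signless_injective:
  fixes z :: "nat \<Rightarrow> complex"
  assumes "\<And>i j. i < m \<Longrightarrow> j < m \<Longrightarrow> H $$ (i, j) * z j + z i * H $$ (j, i) = 0" "i < m"
  shows "z i = 0"
proof (rule anticommuting_eq_0[of "transpose_mat H" z])
  show "mat_adjoint (transpose_mat H) = transpose_mat H"
  proof (rule eq_matI)
    fix i j assume "i < dim_row (transpose_mat H)" "j < dim_col (transpose_mat H)"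
    hence ij: "i < m" "j < m" using H by auto
    hence "H $$ (j, i) = cnj (H $$ (i, j))" using mat_adjoint_index[of j H i] H by simp
    thus "mat_adjoint (transpose_mat H) $$ (i, j) = transpose_mat H $$ (i, j)" using ij H by simp
  qed (use H in auto)
qed (use assms H in auto)

section \<open>Vectors at which the form attains the bounds 2 and -2\<close>

text \<open>A unitary change of basis preserves the form and the norm, so the equality passes to the
  cycle, where it forces the ratio \<epsilon> along each edge.\<close>

lemma extremal_form:
  fixes \<epsilon> :: complex
  assumes x: "x \<in> carrier_vec m" and \<epsilon>: "\<epsilon> = 1 \<or> \<epsilon> = - 1"
    and U: "unitary_mat m U" "H = U * cycle_mat m * mat_adjoint U"
    and eq: "(H *\<^sub>v x) \<bullet>c x = 2 * \<epsilon> * (x \<bullet>c x)" and "i < m"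
  shows "(mat_adjoint U *\<^sub>v x) $ (Suc i mod m) = \<epsilon> * (mat_adjoint U *\<^sub>v x) $ i"
proof (rule cycle_mat_form_diff[OF m3 _ \<epsilon> _ \<open>i < m\<close>])
  note u = unitary_matD[OF U(1)]
  define y where "y = mat_adjoint U *\<^sub>v x"
  have y: "y \<in> carrier_vec m" using u x by (simp add: y_def mult_mat_vec_carrier[of _ m m])
  thus "mat_adjoint U *\<^sub>v x \<in> carrier_vec m" by (simp add: y_def)
  have Uy: "U *\<^sub>v y = x"
    using u x unfolding y_def by (subst assoc_mult_mat_vec[symmetric, of _ m m _ m]) auto
  have "H *\<^sub>v x = U *\<^sub>v (cycle_mat m *\<^sub>v y)"
    unfolding U(2) y_def using u x
    by (simp add: assoc_mult_mat_vec[of _ m m _ m] mult_carrier_mat[of _ m m _ m] mult_mat_vec_carrier[of _ m m])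
  hence "(H *\<^sub>v x) \<bullet>c x = (cycle_mat m *\<^sub>v y) \<bullet>c y"
    using mult_mat_vec_cscalar_adjoint[OF u(1) mult_mat_vec_carrier[OF cycle_mat_carrier y] x]
    by (simp add: y_def)
  moreover have "x \<bullet>c x = y \<bullet>c y"
    using mult_mat_vec_cscalar_adjoint[OF u(1) y x] by (simp add: Uy) (simp add: y_def)
  ultimately show "(cycle_mat m *\<^sub>v (mat_adjoint U *\<^sub>v x)) \<bullet>c (mat_adjoint U *\<^sub>v x)
      = 2 * \<epsilon> * ((mat_adjoint U *\<^sub>v x) \<bullet>c (mat_adjoint U *\<^sub>v x))"
    using eq by (simp add: y_def)
qed

lemma maximal_form:
  obtains e where "e \<in> carrier_vec m" "H *\<^sub>v e = 2 \<cdot>\<^sub>v e"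
    "\<And>x. x \<in> carrier_vec m \<Longrightarrow> (H *\<^sub>v x) \<bullet>c x = 2 * (x \<bullet>c x) \<Longrightarrow> \<exists>c. x = c \<cdot>\<^sub>v e"
proof -
  let ?A = "cycle_mat m"
  obtain U where U: "unitary_mat m U" "H = U * ?A * mat_adjoint U"
    using hermitian_unitarily_similar[OF H cycle_mat_carrier cycle_mat_hermitian char_poly_eq] by metis
  note u = unitary_matD[OF U(1)]
  \<comment> \<open>The all-ones vector is an eigenvector of the cycle for the eigenvalue 2; its
    image under \<open>U\<close> spans the line of maximizers.\<close>
  define o1 :: "complex vec" where "o1 = vec m (\<lambda>_. 1)"
  have o1: "o1 \<in> carrier_vec m" by (simp add: o1_def)
  define e where "e = U *\<^sub>v o1"
  have e: "e \<in> carrier_vec m" using u o1 by (simp add: e_def mult_mat_vec_carrier[of _ m m])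
  have "mat_adjoint U *\<^sub>v e = o1"
    using u o1 unfolding e_def by (subst assoc_mult_mat_vec[symmetric, of _ m m _ m]) auto
  moreover have "?A *\<^sub>v o1 = 2 \<cdot>\<^sub>v o1"
    using cycle_mat_mult_vec[OF m3 o1] m3
    by (intro eq_vecI) (auto simp: o1_def cycle_mat_def)
  ultimately have "H *\<^sub>v e = U *\<^sub>v (2 \<cdot>\<^sub>v o1)"
    unfolding U(2) using u e o1
    by (simp add: assoc_mult_mat_vec[of _ m m _ m] mult_carrier_mat[of _ m m _ m] mult_mat_vec_carrier[of _ m m])
  also have "\<dots> = 2 \<cdot>\<^sub>v e" unfolding e_def using u o1 by (intro mult_mat_vec) auto
  finally have He: "H *\<^sub>v e = 2 \<cdot>\<^sub>v e" .
  have "\<exists>c. x = c \<cdot>\<^sub>v e" if x: "x \<in> carrier_vec m" "(H *\<^sub>v x) \<bullet>c x = 2 * (x \<bullet>c x)" for x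
  proof -
    define y where "y = mat_adjoint U *\<^sub>v x"
    have y: "y \<in> carrier_vec m" using u x by (simp add: y_def mult_mat_vec_carrier[of _ m m])
    have "y $ (Suc i mod m) = 1 * y $ i" if "i < m" for i
      unfolding y_def using extremal_form[OF x(1) _ U, of 1 i] x(2) that by simp
    from cyclic_iterate[OF this] have "y $ (i mod m) = y $ 0" for i
      using m3 by simp
    hence const: "y $ i = y $ 0" if "i < m" for i using that mod_less[OF that] by metis
    have "y = y $ 0 \<cdot>\<^sub>v o1"
    proof (rule eq_vecI)
      fix i assume "i < dim_vec (y $ 0 \<cdot>\<^sub>v o1)"
      thus "y $ i = (y $ 0 \<cdot>\<^sub>v o1) $ i" using const[of i] by (simp add: o1_def)
    qed (use y in \<open>simp add: o1_def\<close>)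
    hence "U *\<^sub>v y = U *\<^sub>v (y $ 0 \<cdot>\<^sub>v o1)" by (rule arg_cong)
    hence "U *\<^sub>v y = y $ 0 \<cdot>\<^sub>v e" unfolding e_def mult_mat_vec[OF u(1) o1] .
    moreover have "U *\<^sub>v y = x"
      using u x unfolding y_def by (subst assoc_mult_mat_vec[symmetric, of _ m m _ m]) auto
    ultimately show ?thesis by metis
  qed
  with that e He show ?thesis by blast
qed

lemma minimal_form:
  assumes x: "x \<in> carrier_vec m" "(H *\<^sub>v x) \<bullet>c x = - 2 * (x \<bullet>c x)"
  shows "x = 0\<^sub>v m"
proof -
  obtain U where U: "unitary_mat m U" "H = U * cycle_mat m * mat_adjoint U"
    using hermitian_unitarily_similar[OF H cycle_mat_carrier cycle_mat_hermitian char_poly_eq] by metis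
  note u = unitary_matD[OF U(1)]
  define y where "y = mat_adjoint U *\<^sub>v x"
  have y: "y \<in> carrier_vec m" using u x by (simp add: y_def mult_mat_vec_carrier[of _ m m])
  have "y $ (Suc i mod m) = - 1 * y $ i" if "i < m" for i
    unfolding y_def using extremal_form[OF x(1) _ U, of "- 1" i] x(2) that by simp
  from cyclic_iterate[OF this] have *: "y $ (k mod m) = (- 1) ^ k * y $ 0" for k
    using m3 by simp
  \<comment> \<open>The sign changes along each edge, so one turn around the odd cycle gives y_0 = -
    y_0.\<close>
  from *[of m] odd_m have "y $ 0 = 0" by simp
  with * have "y $ i = 0" if "i < m" for i using that by (metis mod_less mult_zero_right)
  hence "y = 0\<^sub>v m" using y by (intro eq_vecI) auto
  moreover have "U *\<^sub>v y = x"
    using u x unfolding y_def by (subst assoc_mult_mat_vec[symmetric, of _ m m _ m]) auto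
  moreover have "U *\<^sub>v 0\<^sub>v m = 0\<^sub>v m" using u(1) by auto
  ultimately show ?thesis by simp
qed

end

section \<open>Gain graphs and their cycles\<close>

text \<open>The value at u is the product of the gains along the path from u to its first visit of
  \<open>v\<close>, and 0 where \<open>v\<close> is never reached. The recursion could fail only at
  \<open>v\<close>, where it asks that the product around the cycle be 1.\<close>

lemma cycle_potential:
  fixes f :: "'a \<Rightarrow> 'a" and g :: "'a \<Rightarrow> 'b :: comm_semiring_1"
  assumes k: "k > 0" "(f ^^ k) v = v" "\<And>i. 0 < i \<Longrightarrow> i < k \<Longrightarrow> (f ^^ i) v \<noteq> v"
    and g: "(\<Prod>i<k. g ((f ^^ i) v)) = 1"
  obtains z where "z v = 1" "\<And>u. z u = g u * z (f u)"
proof -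
  define t where "t u = (LEAST s. (f ^^ s) u = v)" for u
  define z where "z u = (if \<exists>s. (f ^^ s) u = v then \<Prod>i<t u. g ((f ^^ i) u) else 0)" for u
  have shift: "g u * (\<Prod>i<s. g ((f ^^ i) (f u))) = (\<Prod>i<Suc s. g ((f ^^ i) u))" for u s
    unfolding prod.lessThan_Suc_shift by (simp add: funpow_swap1)
  have "t v = 0" unfolding t_def by (rule Least_eq_0) simp
  moreover have ex: "\<exists>s. (f ^^ s) v = v" by (rule exI[of _ 0]) simp
  ultimately have zv: "z v = 1" by (simp add: z_def)
  have "z u = g u * z (f u)" for u
  proof (cases "u = v")
    case True
    obtain k' where k': "k = Suc k'" using k(1) by (cases k) auto
    have 1: "(f ^^ k') (f v) = v" using k(2) by (simp add: k' funpow_swap1)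
    \<comment> \<open>From \<open>f v\<close> the first return to \<open>v\<close> takes one step
      less than the full period.\<close>
    have "t (f v) = k'" unfolding t_def
    proof (rule Least_equality)
      show "(f ^^ k') (f v) = v" by (rule 1)
    next
      fix s assume "(f ^^ s) (f v) = v"
      hence "(f ^^ Suc s) v = v" by (simp add: funpow_swap1)
      thus "k' \<le> s" using k(3)[of "Suc s"] k' by force
    qed
    hence "g v * z (f v) = 1" using 1 g shift[of v k'] by (auto simp: z_def k')
    thus ?thesis using True zv by simp
  next
    case False
    show ?thesis
    proof (cases "\<exists>s. (f ^^ s) u = v")
      case True
      then obtain s where s: "(f ^^ s) u = v" by blast
      have "t u = Suc (LEAST s. (f ^^ Suc s) u = v)"
        unfolding t_def using s False by (intro Least_Suc) auto
      hence tu: "t u = Suc (t (f u))" by (simp add: t_def funpow_swap1)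
      obtain s' where "s = Suc s'" using s False by (cases s) auto
      hence "(f ^^ s') (f u) = v" using s by (simp add: funpow_swap1)
      hence "z (f u) = (\<Prod>i<t (f u). g ((f ^^ i) (f u)))" by (auto simp: z_def)
      thus ?thesis using True shift[of u "t (f u)"] by (simp add: z_def tu)
    next
      case F: False
      have "(f ^^ s) (f u) \<noteq> v" for s using F by (metis comp_apply funpow_Suc_right)
      thus ?thesis using F by (simp add: z_def)
    qed
  qed
  with that zv show ?thesis by blast
qed

abbreviation "fourth_roots \<equiv> {1, - 1, \<i>, - \<i>} :: complex set"

lemma fourth_roots_mult: "a \<in> fourth_roots \<Longrightarrow> b \<in> fourth_roots \<Longrightarrow> a * b \<in> fourth_roots"
  by auto

lemma fourth_roots_prod: "(\<And>i. i \<in> A \<Longrightarrow> g i \<in> fourth_roots) \<Longrightarrow> prod g A \<in> fourth_roots"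
  by (induction A rule: infinite_finite_induct) (simp, simp, metis fourth_roots_mult insertCI prod.insert)

section \<open>Gain graphs and the orientation of their edges\<close>

text \<open>The combinatorial part sees only these consequences of cospectrality, phrased for
  functions on indices. The pairs in \<open>edge_count\<close> are ordered, so there are as many
  edges as vertices.\<close>

locale gain_graph =
  fixes m :: nat and h :: "nat \<Rightarrow> nat \<Rightarrow> complex"
  assumes m_pos: "m > 0"
    and hermitian: "i < m \<Longrightarrow> j < m \<Longrightarrow> h j i = cnj (h i j)"
    and entries: "i < m \<Longrightarrow> j < m \<Longrightarrow> h i j \<noteq> 0 \<Longrightarrow> h i j \<in> fourth_roots"
    and loopless: "i < m \<Longrightarrow> h i i = 0"
    and edge_count: "card {(i, j). i < m \<and> j < m \<and> h i j \<noteq> 0} = 2 * m"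
    and signless: "(\<And>i j. i < m \<Longrightarrow> j < m \<Longrightarrow> h i j \<noteq> 0 \<Longrightarrow> z i + z j = 0) \<Longrightarrow> i < m \<Longrightarrow> z i = (0 :: complex)"
    and twisted: "(\<And>i j. i < m \<Longrightarrow> j < m \<Longrightarrow> h i j \<noteq> 0 \<Longrightarrow> h i j * z j + z i * h j i = 0) \<Longrightarrow> i < m \<Longrightarrow> z i = 0"
    and max_form: "\<exists>e. (\<forall>i<m. (\<Sum>j<m. h i j * e j) = 2 * e i) \<and>
       (\<forall>x. (\<Sum>i<m. \<Sum>j<m. cnj (x i) * h i j * x j) = 2 * (\<Sum>i<m. cnj (x i) * x i) \<longrightarrow>
          (\<exists>c. \<forall>i<m. x i = c * e i))"
    and min_form: "(\<Sum>i<m. \<Sum>j<m. cnj (x i) * h i j * x j) = - 2 * (\<Sum>i<m. cnj (x i) * x i)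
       \<Longrightarrow> i < m \<Longrightarrow> x i = 0"
begin

lemma nonzero_sym: "i < m \<Longrightarrow> j < m \<Longrightarrow> h i j \<noteq> 0 \<Longrightarrow> h j i \<noteq> 0"
  using hermitian[of i j] by simp

lemma unimodular: "i < m \<Longrightarrow> j < m \<Longrightarrow> h i j \<noteq> 0 \<Longrightarrow> h i j * h j i = 1"
  using hermitian[of i j] entries[of i j] by auto

text \<open>The signless incidence matrix is square and has trivial kernel, so a nonzero term of its
  determinant matches every vertex with an edge containing it.\<close>

lemma orientation:
  obtains f where "\<And>u. u < m \<Longrightarrow> f u < m" "\<And>u. u < m \<Longrightarrow> h u (f u) \<noteq> 0"
    "\<And>u. u < m \<Longrightarrow> f (f u) \<noteq> u"
    "\<And>i j. i < m \<Longrightarrow> j < m \<Longrightarrow> h i j \<noteq> 0 \<Longrightarrow> j = f i \<or> i = f j"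
proof -
  \<comment> \<open>One ordered pair per edge; these pairs index the rows of the incidence matrix
    \<open>N\<close>.\<close>
  define Q where "Q = {(i, j). i < j \<and> j < m \<and> h i j \<noteq> 0}"
  have Qsub: "Q \<subseteq> {..<m} \<times> {..<m}" by (auto simp: Q_def)
  have finQ: "finite Q" by (rule finite_subset[OF Qsub]) simp
  have "{(i, j). i < m \<and> j < m \<and> h i j \<noteq> 0} = Q \<union> prod.swap ` Q" (is "?L = ?R")
  proof (rule Set.set_eqI)
    fix p :: "nat \<times> nat"
    obtain i j where p: "p = (i, j)" by fastforce
    have "(i, j) \<in> prod.swap ` Q \<longleftrightarrow> (j, i) \<in> Q" by force
    moreover have "(i, j) \<in> ?L \<longleftrightarrow> (i, j) \<in> Q \<or> (j, i) \<in> Q"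
    proof (cases "i < m \<and> j < m")
      case True
      hence "h i j = 0 \<longleftrightarrow> h j i = 0" "h i i = 0" using nonzero_sym loopless by blast+
      with True show ?thesis by (cases i j rule: linorder_cases) (simp_all add: Q_def)
    qed (auto simp: Q_def)
    ultimately show "p \<in> ?L \<longleftrightarrow> p \<in> ?R" unfolding p by blast
  qed
  moreover have "Q \<inter> prod.swap ` Q = {}" by (auto simp: Q_def)
  moreover have "card (prod.swap ` Q) = card Q" by (rule card_image) (auto simp: inj_on_def)
  ultimately have cardQ: "card Q = m" using edge_count finQ by (simp add: card_Un_disjoint)
  obtain e where e: "bij_betw e {0..<m} Q" using ex_bij_betw_nat_finite[OF finQ] cardQ by auto
  define N :: "complex mat" where
    "N = mat m m (\<lambda>(a, v). if v = fst (e a) \<or> v = snd (e a) then 1 else 0)"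
  have N: "N \<in> carrier_mat m m" by (simp add: N_def)
  have eQ: "fst (e a) < snd (e a)" "snd (e a) < m" "h (fst (e a)) (snd (e a)) \<noteq> 0" if "a < m" for a
  proof -
    have "e a \<in> Q" using bij_betwE[OF e] that by simp
    thus "fst (e a) < snd (e a)" "snd (e a) < m" "h (fst (e a)) (snd (e a)) \<noteq> 0"
      by (simp_all add: Q_def case_prod_beta)
  qed
  have eQ': "\<exists>a<m. e a = (i, j)" if "i < j" "j < m" "h i j \<noteq> 0" for i j
  proof -
    have "(i, j) \<in> e ` {0..<m}" using bij_betw_imp_surj_on[OF e] that by (simp add: Q_def)
    thus ?thesis by force
  qed
  \<comment> \<open>The entries of a kernel vector of \<open>N\<close> sum to zero over the ends of
    every edge, so the vector vanishes by \<open>signless\<close>.\<close>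
  have "det N \<noteq> 0"
  proof
    assume "det N = 0"
    then obtain z where z: "z \<in> carrier_vec m" "z \<noteq> 0\<^sub>v m" "N *\<^sub>v z = 0\<^sub>v m"
      using det_0_iff_vec_prod_zero[OF N] by blast
    have ze: "z $ fst (e a) + z $ snd (e a) = 0" if "a < m" for a
    proof -
      have "(N *\<^sub>v z) $ a = (\<Sum>v<m. (if v = fst (e a) \<or> v = snd (e a) then 1 else 0) * z $ v)"
        using that z(1) by (simp add: N_def scalar_prod_def lessThan_atLeast0)
      also have "\<dots> = (\<Sum>v<m. (if v = fst (e a) then z $ v else 0) + (if v = snd (e a) then z $ v else 0))"
        using eQ(1)[OF that] by (intro sum.cong) auto
      also have "\<dots> = z $ fst (e a) + z $ snd (e a)"
        using eQ(1,2)[OF that] by (simp add: sum.distrib)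
      finally show ?thesis using that z(3) by simp
    qed
    have "z $ i + z $ j = 0" if "i < m" "j < m" "h i j \<noteq> 0" for i j
    proof (cases "i < j")
      case True
      from eQ'[OF True that(2,3)] ze show ?thesis by force
    next
      case False
      hence "j < i" using that loopless by (metis linorder_neqE_nat)
      from eQ'[OF this that(1)] nonzero_sym[OF that] ze show ?thesis by (force simp: add.commute)
    qed
    hence "z $ i = 0" if "i < m" for i using signless[of "\<lambda>i. z $ i"] that by blast
    hence "z = 0\<^sub>v m" using z(1) by (intro eq_vecI) auto
    thus False using z(2) by simp
  qed
  then obtain p where p: "p permutes {0..<m}" and pN: "(\<Prod>a = 0..<m. N $$ (a, p a)) \<noteq> 0"
    unfolding det_def'[OF N] by (metis (no_types, lifting) mem_Collect_eq mult_zero_right sum.neutral)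
  have pe: "p a = fst (e a) \<or> p a = snd (e a)" if "a < m" for a
  proof -
    have "N $$ (a, p a) \<noteq> 0" using pN that by auto
    moreover have "p a < m" using permutes_in_image[OF p, of a] that by simp
    ultimately show ?thesis using that by (auto simp: N_def split: if_splits)
  qed
  define q where "q = inv_into UNIV p"
  have q: "q u < m" "p (q u) = u" if "u < m" for u
    using permutes_in_image[OF permutes_inv[OF p], of u] permutes_inverses(1)[OF p] that
    by (auto simp: q_def)
  have qp: "q (p a) = a" for a using permutes_inverses(2)[OF p] by (simp add: q_def)
  \<comment> \<open>\<open>q u\<close> is the edge matched with \<open>u\<close>, and
    \<open>f u\<close> is the other end of that edge.\<close>
  define f where "f u = (if u = fst (e (q u)) then snd (e (q u)) else fst (e (q u)))" for u
  have fe: "e (q u) = (u, f u) \<or> e (q u) = (f u, u)" if "u < m" for u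
    using pe[OF q(1)[OF that]] q(2)[OF that] by (auto simp: f_def prod_eq_iff)
  have flt: "f u < m" and fh: "h u (f u) \<noteq> 0" if "u < m" for u
    using fe[OF that] eQ[OF q(1)[OF that]] nonzero_sym[of "f u" u] that by auto
  \<comment> \<open>Otherwise \<open>u\<close> and \<open>f u\<close> would be matched with the same
    edge.\<close>
  have ff: "f (f u) \<noteq> u" if "u < m" for u
  proof
    assume a: "f (f u) = u"
    have "e (q u) = e (q (f u))"
      using fe[OF that] fe[OF flt[OF that]] eQ(1)[OF q(1)[OF that]] eQ(1)[OF q(1)[OF flt[OF that]]]
      unfolding a by auto
    hence "q u = q (f u)" using e q flt that unfolding bij_betw_def inj_on_def by auto
    hence "u = f u" using q flt that by metis
    thus False using fh[OF that] loopless[OF that] by simp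
  qed
  have cover: "j = f i \<or> i = f j" if "i < m" "j < m" "h i j \<noteq> 0" for i j
  proof -
    \<comment> \<open>The edge with index \<open>a\<close> is matched with its end
      \<open>p a\<close>, and \<open>f\<close> maps this end to the other one.\<close>
    have main: "j = f i \<or> i = f j" if ij: "i < j" "j < m" "h i j \<noteq> 0" for i j
    proof -
      obtain a where a: "a < m" "e a = (i, j)" using eQ'[OF ij] by blast
      have "p a < m" using permutes_in_image[OF p, of a] a by simp
      from fe[OF this] a show ?thesis unfolding qp by auto
    qed
    have "i \<noteq> j" using that loopless by auto
    thus ?thesis using main[of i j] main[of j i] nonzero_sym[OF that] that by (cases i j rule: linorder_cases) auto
  qed
  show ?thesis by (rule that[of f]) (use flt fh ff cover in auto)
qed

end

section \<open>Cycles of the orientation, their lengths and weights\<close>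

text \<open>Equal iterates at i < j would make k - j + i a shorter positive period.\<close>

lemma funpow_orbit_inj:
  assumes "(f ^^ k) v = v" "\<And>i. 0 < i \<Longrightarrow> i < k \<Longrightarrow> (f ^^ i) v \<noteq> v"
  shows "inj_on (\<lambda>i. (f ^^ i) v) {..<k}"
proof (rule linorder_inj_onI)
  fix i j assume ij: "i < j" "i \<in> {..<k}" "j \<in> {..<k}"
  show "(f ^^ i) v \<noteq> (f ^^ j) v"
  proof
    assume eq: "(f ^^ i) v = (f ^^ j) v"
    have "(f ^^ (k - j + i)) v = (f ^^ (k - j)) ((f ^^ i) v)" by (simp add: funpow_add)
    also have "\<dots> = (f ^^ (k - j + j)) v" unfolding eq by (simp add: funpow_add)
    also have "\<dots> = v" using ij assms(1) by simp
    finally have "(f ^^ (k - j + i)) v = v" .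
    moreover have "(f ^^ (k - j + i)) v \<noteq> v" by (rule assms(2)) (use ij in auto)
    ultimately show False by contradiction
  qed
qed auto

text \<open>Every edge is assigned to exactly one of its ends: \<open>f_cover\<close> gives at least
  one, \<open>f_f\<close> at most one.\<close>

locale oriented_gain_graph = gain_graph +
  fixes f :: "nat \<Rightarrow> nat"
  assumes f_less: "u < m \<Longrightarrow> f u < m"
    and f_edge: "u < m \<Longrightarrow> h u (f u) \<noteq> 0"
    and f_f: "u < m \<Longrightarrow> f (f u) \<noteq> u"
    and f_cover: "i < m \<Longrightarrow> j < m \<Longrightarrow> h i j \<noteq> 0 \<Longrightarrow> j = f i \<or> i = f j"
begin

definition is_cycle :: "nat \<Rightarrow> nat \<Rightarrow> bool" where
  "is_cycle v k \<longleftrightarrow> v < m \<and> k > 0 \<and> (f ^^ k) v = v \<and> (\<forall>i. 0 < i \<and> i < k \<longrightarrow> (f ^^ i) v \<noteq> v)"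

definition orbit :: "nat \<Rightarrow> nat \<Rightarrow> nat set" where
  "orbit v k = (\<lambda>i. (f ^^ i) v) ` {..<k}"

definition weight :: "nat \<Rightarrow> nat \<Rightarrow> complex" where
  "weight v k = (\<Prod>i<k. h ((f ^^ i) v) (f ((f ^^ i) v)))"

lemma funpow_less: "u < m \<Longrightarrow> (f ^^ i) u < m"
  by (induction i) (auto intro: f_less)

lemma orbit_less: "is_cycle v k \<Longrightarrow> u \<in> orbit v k \<Longrightarrow> u < m"
  by (auto simp: orbit_def is_cycle_def intro: funpow_less)

lemma start_in_orbit: "is_cycle v k \<Longrightarrow> v \<in> orbit v k"
  by (force simp: orbit_def is_cycle_def)

lemma f_orbit:
  assumes "is_cycle v k" "u \<in> orbit v k"
  shows "f u \<in> orbit v k"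
proof -
  obtain i where i: "i < k" "u = (f ^^ i) v" using assms(2) by (auto simp: orbit_def)
  show ?thesis
  proof (cases "Suc i = k")
    case True
    hence "f u = v" using assms(1) i by (auto simp: is_cycle_def)
    thus ?thesis using start_in_orbit[OF assms(1)] by simp
  next
    case False
    thus ?thesis using i by (auto simp: orbit_def intro!: image_eqI[of _ _ "Suc i"])
  qed
qed

text \<open>The iterates of a point in a finite closed set repeat, and the least period of a
  repeated point gives a cycle.\<close>

lemma cycle_in_closed_set:
  assumes "u \<in> B" "B \<subseteq> {..<m}" "\<And>u. u \<in> B \<Longrightarrow> f u \<in> B"
  obtains v k where "is_cycle v k" "v \<in> B"
proof -
  have inB: "(f ^^ i) u \<in> B" for i using assms(1,3) by (induction i) auto
  hence "(\<lambda>i. (f ^^ i) u) ` UNIV \<subseteq> {..<m}" using assms(2) by blast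
  hence "\<not> inj (\<lambda>i. (f ^^ i) u)" using finite_imageD finite_subset finite_lessThan infinite_UNIV_nat by metis
  then obtain i j where ij: "i < j" "(f ^^ i) u = (f ^^ j) u"
    unfolding inj_def by (metis linorder_neqE_nat)
  define v where "v = (f ^^ i) u"
  have "(f ^^ (j - i)) v = (f ^^ (j - i + i)) u" unfolding v_def by (simp only: funpow_add comp_apply)
  hence per: "0 < j - i \<and> (f ^^ (j - i)) v = v" using ij by (simp add: v_def)
  define k where "k = (LEAST k. 0 < k \<and> (f ^^ k) v = v)"
  have "0 < k \<and> (f ^^ k) v = v" unfolding k_def by (rule LeastI[of _ "j - i"]) (rule per)
  moreover have "(f ^^ s) v \<noteq> v" if "0 < s" "s < k" for s
    using that not_less_Least[of s "\<lambda>k. 0 < k \<and> (f ^^ k) v = v"] unfolding k_def by blast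
  moreover have "v < m" using inB[of i] assms(2) by (auto simp: v_def)
  ultimately have "is_cycle v k" by (simp add: is_cycle_def)
  thus ?thesis using that inB[of i] by (simp add: v_def)
qed

lemma cycle_potentialE:
  assumes "is_cycle v k" "(\<Prod>i<k. g ((f ^^ i) v)) = (1 :: complex)"
  obtains z where "z v = 1" "\<And>u. z u = g u * z (f u)"
  using cycle_potential[of k f v g] assms unfolding is_cycle_def by metis

lemma edge_cases:
  assumes "i < m" "j < m" "h i j \<noteq> 0"
  obtains "j = f i" | "i = f j"
  using f_cover[OF assms] by blast

lemma weight_fourth_root: "is_cycle v k \<Longrightarrow> weight v k \<in> fourth_roots"
  unfolding weight_def is_cycle_def
  by (intro fourth_roots_prod entries f_edge f_less funpow_less) simp_all

text \<open>For even k the constant gain -1 multiplies to 1 around the cycle. Its potential is a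
  nonzero kernel vector of the signless incidence matrix, since every edge joins some u with
  \<open>f u\<close>.\<close>

lemma cycle_odd:
  assumes "is_cycle v k"
  shows "odd k"
proof
  assume "even k"
  hence "(\<Prod>i<k. - 1 :: complex) = 1" by simp
  then obtain z :: "nat \<Rightarrow> complex" where z: "z v = 1" "\<And>u. z u = - 1 * z (f u)"
    using cycle_potentialE[OF assms, of "\<lambda>_. - 1"] by metis
  have "z v = 0"
  proof (rule signless[of z])
    fix i j assume "i < m" "j < m" "h i j \<noteq> 0"
    thus "z i + z j = 0" by (rule edge_cases) (use z(2)[of i] z(2)[of j] in simp_all)
  qed (use assms in \<open>simp add: is_cycle_def\<close>)
  thus False using z(1) by simp
qed

text \<open>The gains -h^2 multiply to -W^2 around the odd cycle, with W its weight. If W^2 = -1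
  this product is 1, and the potential solves the twisted equations.\<close>

lemma weight_square:
  assumes "is_cycle v k"
  shows "(weight v k)\<^sup>2 \<noteq> - 1"
proof
  assume W: "(weight v k)\<^sup>2 = - 1"
  have "(\<Prod>i<k. - (h ((f ^^ i) v) (f ((f ^^ i) v)))\<^sup>2) = (- 1) ^ k * (weight v k)\<^sup>2"
    unfolding weight_def prod_power_distrib by (simp add: prod_uminus)
  also have "\<dots> = 1" using cycle_odd[OF assms] by (simp add: W)
  finally obtain z :: "nat \<Rightarrow> complex" where z: "z v = 1" "\<And>u. z u = - (h u (f u))\<^sup>2 * z (f u)"
    using cycle_potentialE[OF assms, of "\<lambda>u. - (h u (f u))\<^sup>2"] by metis
  have "z v = 0"
  proof (rule twisted[of z])
    fix i j assume ij: "i < m" "j < m" "h i j \<noteq> 0"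
    have hh: "h i j * h j i = 1" by (rule unimodular[OF ij])
    from ij show "h i j * z j + z i * h j i = 0"
    proof (rule edge_cases)
      assume j: "j = f i"
      \<comment> \<open>Once the recursion is substituted, the two terms cancel because the entries
        in opposite directions multiply to 1.\<close>
      have "h i j * z j + z i * h j i = h i j * z j - h i j * z j * (h i j * h j i)"
        using z(2)[of i] by (simp add: j power2_eq_square algebra_simps)
      thus ?thesis by (simp add: hh)
    next
      assume i: "i = f j"
      have "h i j * z j + z i * h j i = h j i * z i - h j i * z i * (h i j * h j i)"
        using z(2)[of j] by (simp add: i power2_eq_square algebra_simps)
      thus ?thesis by (simp add: hh)
    qed
  qed (use assms in \<open>simp add: is_cycle_def\<close>)
  thus False using z(1) by simp
qed

section \<open>Test vectors supported on a cycle\<close>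

text \<open>The ordered adjacent pairs are the pairs (u, f u) and (f u, u), each arising once; the
  two families are disjoint by \<open>f_f\<close>.\<close>

lemma quadratic_form:
  "(\<Sum>i<m. \<Sum>j<m. cnj (x i) * h i j * x j)
   = (\<Sum>u<m. cnj (x u) * h u (f u) * x (f u)) + (\<Sum>u<m. cnj (x (f u)) * h (f u) u * x u)"
proof -
  let ?t = "\<lambda>(i, j). cnj (x i) * h i j * x j"
  define S where "S = (\<lambda>u. (u, f u)) ` {..<m}"
  define T where "T = (\<lambda>u. (f u, u)) ` {..<m}"
  have sub: "S \<union> T \<subseteq> {..<m} \<times> {..<m}" using f_less by (auto simp: S_def T_def)
  have disj: "S \<inter> T = {}" using f_f by (auto simp: S_def T_def)
  have "?t p = 0" if P: "p \<in> {..<m} \<times> {..<m} - (S \<union> T)" for p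
  proof -
    obtain i j where p: "p = (i, j)" "i < m" "j < m" using P by auto
    hence "h i j = 0" using P f_cover[of i j] by (auto simp: S_def T_def)
    thus ?thesis by (simp add: p)
  qed
  hence "(\<Sum>p\<in>{..<m} \<times> {..<m}. ?t p) = (\<Sum>p\<in>S \<union> T. ?t p)"
    by (intro sum.mono_neutral_right sub) auto
  also have "\<dots> = sum ?t S + sum ?t T"
    using disj by (intro sum.union_disjoint) (auto simp: S_def T_def)
  also have "sum ?t S = (\<Sum>u<m. cnj (x u) * h u (f u) * x (f u))"
    unfolding S_def by (subst sum.reindex) (auto simp: inj_on_def)
  also have "sum ?t T = (\<Sum>u<m. cnj (x (f u)) * h (f u) u * x u)"
    unfolding T_def by (subst sum.reindex) (auto simp: inj_on_def)
  finally show ?thesis by (simp add: sum.cartesian_product)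
qed

text \<open>Both signs occur: \<epsilon> = -1 excludes the weight -1, and \<epsilon> = 1 yields
  eigenvectors. The recursion is kept because it determines the entries along the cycle.\<close>

definition test_vector :: "nat \<Rightarrow> nat \<Rightarrow> complex \<Rightarrow> (nat \<Rightarrow> complex) \<Rightarrow> bool" where
  "test_vector v k \<epsilon> x \<longleftrightarrow> x v = 1 \<and> (\<forall>u. u \<notin> orbit v k \<longrightarrow> x u = 0) \<and>
     (\<forall>u\<in>orbit v k. x u = \<epsilon> * h u (f u) * x (f u)) \<and>
     (\<Sum>i<m. \<Sum>j<m. cnj (x i) * h i j * x j) = 2 * \<epsilon> * (\<Sum>i<m. cnj (x i) * x i)"

lemma test_vectorD:
  assumes "test_vector v k \<epsilon> x"
  shows "x v = 1" "\<And>u. u \<notin> orbit v k \<Longrightarrow> x u = 0"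
    "\<And>u. u \<in> orbit v k \<Longrightarrow> x u = \<epsilon> * h u (f u) * x (f u)"
    "(\<Sum>i<m. \<Sum>j<m. cnj (x i) * h i j * x j) = 2 * \<epsilon> * (\<Sum>i<m. cnj (x i) * x i)"
  using assms unfolding test_vector_def by blast+

text \<open>The potential for the gains \<epsilon> h, cut off outside the cycle. The pairs (u, f u)
  and (f u, u) each contribute \<epsilon> |x_u|^2, which is 0 for u outside; so trees attached to
  the cycle do not disturb the value.\<close>

lemma cycle_test_vector:
  assumes cyc: "is_cycle v k" and \<epsilon>: "\<epsilon> = 1 \<or> \<epsilon> = - 1" and W: "\<epsilon> ^ k * weight v k = 1"
  obtains x where "test_vector v k \<epsilon> x"
proof -
  have "(\<Prod>i<k. \<epsilon> * h ((f ^^ i) v) (f ((f ^^ i) v))) = 1"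
    using W by (simp add: prod.distrib weight_def)
  then obtain z where z: "z v = 1" "\<And>u. z u = (\<epsilon> * h u (f u)) * z (f u)"
    using cycle_potentialE[OF cyc, of "\<lambda>u. \<epsilon> * h u (f u)"] by metis
  define x where "x u = (if u \<in> orbit v k then z u else 0)" for u
  have x0: "x u = 0" if "u \<notin> orbit v k" for u using that by (simp add: x_def)
  have xf: "x u = \<epsilon> * h u (f u) * x (f u)" if "u \<in> orbit v k" for u
    using that f_orbit[OF cyc that] z(2)[of u] by (simp add: x_def)
  have hx: "cnj (x u) * h u (f u) * x (f u) = \<epsilon> * (cnj (x u) * x u)" for u
  proof (cases "u \<in> orbit v k")
    case True
    have "\<epsilon> * x u = (\<epsilon> * \<epsilon>) * (h u (f u) * x (f u))" using xf[OF True] by (simp only: mult.assoc)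
    hence "h u (f u) * x (f u) = \<epsilon> * x u" using \<epsilon> by auto
    thus ?thesis by (simp add: mult.assoc)
  qed (simp add: x0)
  have hx': "cnj (x (f u)) * h (f u) u * x u = \<epsilon> * (cnj (x u) * x u)" if "u < m" for u
  proof -
    have "cnj (x (f u)) * h (f u) u * x u = cnj (cnj (x u) * h u (f u) * x (f u))"
      using hermitian[OF that f_less[OF that]] by simp
    also have "\<dots> = \<epsilon> * (cnj (x u) * x u)" unfolding hx using \<epsilon> by auto
    finally show ?thesis .
  qed
  have "(\<Sum>i<m. \<Sum>j<m. cnj (x i) * h i j * x j) = 2 * \<epsilon> * (\<Sum>i<m. cnj (x i) * x i)"
  proof -
    have "(\<Sum>u<m. cnj (x (f u)) * h (f u) u * x u) = (\<Sum>u<m. \<epsilon> * (cnj (x u) * x u))"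
      using hx' by (intro sum.cong) auto
    thus ?thesis unfolding quadratic_form hx sum_distrib_left[symmetric] by simp
  qed
  moreover have "x v = 1" using z(1) start_in_orbit[OF cyc] by (simp add: x_def)
  ultimately have "test_vector v k \<epsilon> x" using x0 xf unfolding test_vector_def by blast
  thus ?thesis by (rule that)
qed

text \<open>Of the four possible values, the imaginary ones are excluded by
  \<open>weight_square\<close>, and -1 by a test vector attaining the minimum, which exists because
  (-1)^k (-1) = 1 for odd k.\<close>

lemma weight_eq_1:
  assumes cyc: "is_cycle v k"
  shows "weight v k = 1"
proof -
  have "weight v k \<noteq> - 1"
  proof
    assume "weight v k = - 1"
    hence "(- 1) ^ k * weight v k = 1" using cycle_odd[OF cyc] by simp
    then obtain x where "test_vector v k (- 1) x"
      using cycle_test_vector[OF cyc, of "- 1"] by blast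
    note x = test_vectorD[OF this]
    have "x v = 0" using min_form[of x v] x(4) cyc by (simp add: is_cycle_def)
    thus False using x(1) by simp
  qed
  moreover have "weight v k \<noteq> \<i>" "weight v k \<noteq> - \<i>" using weight_square[OF cyc] by auto
  ultimately show ?thesis using weight_fourth_root[OF cyc] by blast
qed

lemma extremal_vector:
  assumes "is_cycle v k"
  obtains x where "test_vector v k 1 x"
  using cycle_test_vector[OF assms, of 1] weight_eq_1[OF assms] by auto

text \<open>Starting from the value 1, each step along the cycle multiplies by a fourth root of
  unity. So the vector vanishes nowhere on the cycle, and its entries are admissible for
  switching.\<close>

lemma extremal_vector_fourth_root:
  assumes cyc: "is_cycle v k" and "test_vector v k 1 x" and u: "u \<in> orbit v k"
  shows "x u \<in> fourth_roots"
proof -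
  note x = test_vectorD[OF assms(2)]
  have "x ((f ^^ i) v) \<in> fourth_roots \<and> (f ^^ i) v \<in> orbit v k" for i
  proof (induction i)
    case (Suc i)
    define u where "u = (f ^^ i) v"
    have u: "x u \<in> fourth_roots" "u \<in> orbit v k" using Suc by (auto simp: u_def)
    have um: "u < m" "f u < m" using orbit_less[OF cyc u(2)] f_less by auto
    have "h (f u) u * x u = x (f u) * (h u (f u) * h (f u) u)"
      using x(3)[OF u(2)] by simp
    hence xfu: "x (f u) = h (f u) u * x u" using unimodular[OF um f_edge[OF um(1)]] by simp
    have "x (f u) \<in> fourth_roots" unfolding xfu
      by (rule fourth_roots_mult[OF entries[OF um(2,1) nonzero_sym[OF um f_edge[OF um(1)]]] u(1)])
    thus ?case using f_orbit[OF cyc u(2)] by (simp add: u_def)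
  qed (use x(1) start_in_orbit[OF cyc] in auto)
  thus ?thesis using u unfolding orbit_def by blast
qed

section \<open>Uniqueness of the cycle, and switching\<close>

text \<open>An extremal vector is an eigenvector and vanishes exactly outside its cycle. The
  eigenvalue equation at an outside vertex u leaves only the term at \<open>f u\<close>, so
  \<open>f u\<close> is outside too. Hence a second cycle lies outside, and its extremal vector
  would have to be proportional to the first.\<close>

lemma orbit_eq:
  assumes cyc: "is_cycle v k"
  shows "orbit v k = {..<m}"
proof (rule ccontr)
  assume ne: "orbit v k \<noteq> {..<m}"
  define B where "B = {..<m} - orbit v k"
  have "orbit v k \<subseteq> {..<m}" using orbit_less[OF cyc] by auto
  hence "B \<noteq> {}" using ne by (auto simp: B_def)
  then obtain u0 where u0: "u0 \<in> B" by blast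
  obtain e :: "nat \<Rightarrow> complex" where e: "\<And>i. i < m \<Longrightarrow> (\<Sum>j<m. h i j * e j) = 2 * e i"
    "\<And>x. (\<Sum>i<m. \<Sum>j<m. cnj (x i) * h i j * x j) = 2 * (\<Sum>i<m. cnj (x i) * x i)
       \<Longrightarrow> \<exists>c. \<forall>i<m. x i = c * e i"
    using max_form by blast
  obtain x where tv: "test_vector v k 1 x" using extremal_vector[OF cyc] by blast
  note x = test_vectorD[OF tv, unfolded mult_1 mult_1_right]
  obtain c where c: "\<And>i. i < m \<Longrightarrow> x i = c * e i" using e(2)[OF x(4)] by blast
  have vm: "v < m" using cyc by (simp add: is_cycle_def)
  have c0: "c \<noteq> 0" using c[OF vm] x(1) by auto
  have closed: "f u \<in> B" if u: "u \<in> B" for u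
  proof -
    have um: "u < m" "f u < m" "u \<notin> orbit v k" using u f_less by (auto simp: B_def)
    \<comment> \<open>As a multiple of \<open>e\<close>, the vector \<open>x\<close> satisfies the
      eigenvalue equation at \<open>u\<close>.\<close>
    have "(\<Sum>j<m. h u j * x j) = c * (\<Sum>j<m. h u j * e j)"
      using c by (simp add: sum_distrib_left mult_ac)
    also have "\<dots> = 2 * x u" using e(1)[OF um(1)] c[OF um(1)] by simp
    also have "\<dots> = 0" using x(2)[OF um(3)] by simp
    finally have 0: "(\<Sum>j<m. h u j * x j) = 0" .
    \<comment> \<open>A neighbour j other than \<open>f u\<close> satisfies u = f j; were j on the
      cycle, u would be as well.\<close>
    have "h u j * x j = 0" if "j < m" "j \<noteq> f u" for j
    proof (rule ccontr)
      assume a: "h u j * x j \<noteq> 0"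
      hence "u = f j" using f_cover[OF um(1) that(1)] that(2) by auto
      moreover have "j \<in> orbit v k" using a x(2)[of j] by auto
      ultimately show False using f_orbit[OF cyc] um(3) by blast
    qed
    hence "(\<Sum>j<m. h u j * x j) = h u (f u) * x (f u)"
      using um(2) by (subst sum.mono_neutral_right[of _ "{f u}"]) auto
    hence "x (f u) = 0" using 0 f_edge[OF um(1)] by simp
    hence "f u \<notin> orbit v k" using extremal_vector_fourth_root[OF cyc tv, of "f u"] by auto
    thus ?thesis using um by (simp add: B_def)
  qed
  obtain v' k' where v': "is_cycle v' k'" "v' \<in> B"
    using cycle_in_closed_set[of u0 B] u0 closed by (auto simp: B_def)
  have orbB: "(f ^^ i) v' \<in> B" for i using v'(2) closed by (induction i) auto
  obtain x' where tv: "test_vector v' k' 1 x'" using extremal_vector[OF v'(1)] by blast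
  note x' = test_vectorD[OF tv, unfolded mult_1 mult_1_right]
  obtain c' where c': "\<And>i. i < m \<Longrightarrow> x' i = c' * e i" using e(2)[OF x'(4)] by blast
  have v'm: "v' < m" "v' \<notin> orbit v k" using v'(2) by (auto simp: B_def)
  \<comment> \<open>\<open>e\<close> vanishes off the first cycle, whereas the second extremal
    vector has the value 1 at \<open>v'\<close>.\<close>
  have "c * e v' = 0" using c[OF v'm(1)] x(2)[OF v'm(2)] by simp
  hence "x' v' = 0" using c'[OF v'm(1)] c0 by simp
  thus False using x'(1) by simp
qed

text \<open>The cycle passes through all vertices, so iterating \<open>f\<close> lists them in
  cyclic order. The extremal vector writes each gain h u (f u) as x u times the conjugate of x (f
  u), which switching removes.\<close>

lemma switching_to_cycle:
  obtains v d where "bij_betw v {..<m} {..<m}" "\<And>i. i < m \<Longrightarrow> d i \<in> fourth_roots"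
    "\<And>i j. i < m \<Longrightarrow> j < m \<Longrightarrow> h (v i) (v j) = cnj (d i) * cycle_adj m i j * d j"
proof -
  obtain v0 k where cyc: "is_cycle v0 k"
    by (rule cycle_in_closed_set[of 0 "{..<m}"]) (use m_pos f_less in auto)
  define v where "v i = (f ^^ i) v0" for i
  have inj: "inj_on v {..<k}"
    unfolding v_def using cyc by (intro funpow_orbit_inj) (auto simp: is_cycle_def)
  have img: "v ` {..<k} = {..<m}"
    using orbit_eq[OF cyc] by (simp add: orbit_def v_def)
  have km: "k = m" using card_image[OF inj] img by simp
  have bij: "bij_betw v {..<m} {..<m}" using inj img by (simp add: bij_betw_def km)
  have vm: "v i < m" for i using cyc by (simp add: v_def is_cycle_def funpow_less)
  have fv: "f (v i) = v (Suc i mod m)" if "i < m" for i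
  proof (cases "Suc i = m")
    case True
    have "f (v i) = (f ^^ m) v0" by (simp add: v_def True[symmetric])
    thus ?thesis using cyc by (simp add: is_cycle_def km v_def True)
  qed (use that in \<open>simp add: v_def\<close>)
  obtain x where tv: "test_vector v0 k 1 x" using extremal_vector[OF cyc] by blast
  note x = test_vectorD[OF tv, unfolded mult_1 mult_1_right]
  \<comment> \<open>Conjugated, because the left factor of the switching carries the conjugate of
    \<open>d\<close>.\<close>
  define d where "d i = cnj (x (v i))" for i
  have xr: "x u \<in> fourth_roots" if "u < m" for u using extremal_vector_fourth_root[OF cyc tv] orbit_eq[OF cyc] that by blast
  have forward: "h u (f u) = x u * cnj (x (f u))" if "u < m" for u
  proof -
    have "x (f u) * cnj (x (f u)) = 1" using xr[OF f_less[OF that]] by auto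
    moreover have "x u = h u (f u) * x (f u)" using x(3) orbit_eq[OF cyc] that by simp
    ultimately show ?thesis by (simp add: mult.assoc)
  qed
  have "h (v i) (v j) = cnj (d i) * cycle_adj m i j * d j" if ij: "i < m" "j < m" for i j
  proof -
    have inj': "v a = v b \<longleftrightarrow> a = b" if "a < m" "b < m" for a b
      using inj that by (auto simp: km inj_on_def)
    have s: "Suc a mod m < m" for a using m_pos by simp
    have 1: "j = Suc i mod m \<longleftrightarrow> v j = f (v i)" using ij inj' s fv by auto
    have 2: "i = Suc j mod m \<longleftrightarrow> v i = f (v j)" using ij inj' s fv by auto
    consider "v j = f (v i)" | "v i = f (v j)" | "v j \<noteq> f (v i)" "v i \<noteq> f (v j)" by blast
    thus ?thesis
    proof cases
      case 1
      thus ?thesis using forward[OF vm[of i]] ij inj' s fv by (auto simp: d_def cycle_adj_def)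
    next
      case 2
      have "h (v i) (v j) = cnj (h (v j) (v i))" by (rule hermitian[OF vm vm])
      also have "\<dots> = x (v i) * cnj (x (v j))" using forward[OF vm[of j]] 2 by simp
      finally show ?thesis using \<open>i = Suc j mod m \<longleftrightarrow> v i = f (v j)\<close> 2 by (simp add: d_def cycle_adj_def)
    next
      case 3
      hence "h (v i) (v j) = 0" using f_cover[OF vm vm] by blast
      thus ?thesis using 1 2 3 by (simp add: cycle_adj_def)
    qed
  qed
  moreover have "d i \<in> fourth_roots" if "i < m" for i using xr[OF vm[of i]] by (auto simp: d_def)
  ultimately show ?thesis using that[of v d] bij by blast
qed

end

lemma (in gain_graph) switching_to_cycle:
  obtains v d where "bij_betw v {..<m} {..<m}" "\<And>i. i < m \<Longrightarrow> d i \<in> fourth_roots"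
    "\<And>i j. i < m \<Longrightarrow> j < m \<Longrightarrow> h (v i) (v j) = cnj (d i) * cycle_adj m i j * d j"
proof -
  obtain f where "\<And>u. u < m \<Longrightarrow> f u < m" "\<And>u. u < m \<Longrightarrow> h u (f u) \<noteq> 0"
    "\<And>u. u < m \<Longrightarrow> f (f u) \<noteq> u"
    "\<And>i j. i < m \<Longrightarrow> j < m \<Longrightarrow> h i j \<noteq> 0 \<Longrightarrow> j = f i \<or> i = f j"
    using orientation by blast
  then interpret oriented_gain_graph m h f by unfold_locales blast+
  show ?thesis using switching_to_cycle that by blast
qed

section \<open>Mixed graphs cospectral with an odd cycle\<close>

text \<open>Passes from matrices and vectors to functions on indices; only here are the nonzero
  entries required to be fourth roots of unity.\<close>

lemma (in cospectral_cycle) gain_graph: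
  assumes entries: "\<And>i j. i < m \<Longrightarrow> j < m \<Longrightarrow> H $$ (i, j) \<noteq> 0 \<Longrightarrow> H $$ (i, j) \<in> fourth_roots"
    and loopless: "\<And>i. i < m \<Longrightarrow> H $$ (i, i) = 0"
  shows "gain_graph m (\<lambda>i j. H $$ (i, j))"
proof
  show "m > 0" using m3 by simp
  show herm: "H $$ (j, i) = cnj (H $$ (i, j))" if "i < m" "j < m" for i j
    using mat_adjoint_index[of j H i] H that by simp
  show "H $$ (i, j) \<in> fourth_roots" if "i < m" "j < m" "H $$ (i, j) \<noteq> 0" for i j
    using entries that by blast
  show "H $$ (i, i) = 0" if "i < m" for i using loopless that .
  show "card {(i, j). i < m \<and> j < m \<and> H $$ (i, j) \<noteq> 0} = 2 * m"
  proof -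
    let ?P = "{(i, j). i < m \<and> j < m \<and> H $$ (i, j) \<noteq> 0}"
    have sub: "?P \<subseteq> {..<m} \<times> {..<m}" by auto
    \<comment> \<open>Nonzero entries have modulus 1, so the trace of the square counts the ordered
      adjacent pairs.\<close>
    have "of_nat (2 * m) = (\<Sum>(i, j)\<in>{..<m} \<times> {..<m}. H $$ (i, j) * H $$ (j, i))"
      unfolding sum_norm_entries[symmetric] by (rule sum.cartesian_product)
    also have "\<dots> = (\<Sum>(i, j)\<in>?P. H $$ (i, j) * H $$ (j, i))"
      by (rule sum.mono_neutral_right[OF _ sub]) auto
    also have "\<dots> = (\<Sum>p\<in>?P. 1)"
    proof (rule sum.cong)
      fix p assume "p \<in> ?P"
      then obtain i j where p: "p = (i, j)" "i < m" "j < m" "H $$ (i, j) \<noteq> 0" by auto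
      have "H $$ (i, j) * cnj (H $$ (i, j)) = 1" using entries[OF p(2-4)] by auto
      thus "(case p of (i, j) \<Rightarrow> H $$ (i, j) * H $$ (j, i)) = 1" using herm[OF p(2,3)] p(1) by simp
    qed simp
    finally have "(of_nat (card ?P) :: complex) = of_nat (2 * m)" by simp
    thus ?thesis by (simp only: of_nat_eq_iff)
  qed
  show "z i = 0" if "\<And>i j. i < m \<Longrightarrow> j < m \<Longrightarrow> H $$ (i, j) \<noteq> 0 \<Longrightarrow> z i + z j = 0" "i < m"
    for z :: "nat \<Rightarrow> complex" and i using signless_injective[of z i] that by blast
  show "z i = 0" if z: "\<And>i j. i < m \<Longrightarrow> j < m \<Longrightarrow> H $$ (i, j) \<noteq> 0 \<Longrightarrow> H $$ (i, j) * z j + z i * H $$ (j, i) = 0"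
    and "i < m" for z i
  proof (rule twisted_signless_injective[of z])
    fix i j assume ij: "i < m" "j < m"
    show "H $$ (i, j) * z j + z i * H $$ (j, i) = 0"
      using z[OF ij] herm[OF ij] by (cases "H $$ (i, j) = 0") auto
  qed fact
  have form: "(H *\<^sub>v vec m x) \<bullet>c vec m x = (\<Sum>i<m. \<Sum>j<m. cnj (x i) * H $$ (i, j) * x j)"
    for x :: "nat \<Rightarrow> complex"
    using H(1) by (simp add: scalar_prod_def lessThan_atLeast0 sum_distrib_left sum_distrib_right mult_ac)
  have norm: "vec m x \<bullet>c vec m x = (\<Sum>i<m. cnj (x i) * x i)" for x :: "nat \<Rightarrow> complex"
    by (simp add: scalar_prod_def lessThan_atLeast0 mult.commute)
  obtain e where e: "e \<in> carrier_vec m" "H *\<^sub>v e = 2 \<cdot>\<^sub>v e"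
    "\<And>x. x \<in> carrier_vec m \<Longrightarrow> (H *\<^sub>v x) \<bullet>c x = 2 * (x \<bullet>c x) \<Longrightarrow> \<exists>c. x = c \<cdot>\<^sub>v e"
    using maximal_form by blast
  have "(\<Sum>j<m. H $$ (i, j) * e $ j) = 2 * e $ i" if "i < m" for i
  proof -
    have "(H *\<^sub>v e) $ i = (\<Sum>j<m. H $$ (i, j) * e $ j)"
      using that e(1) H(1) by (simp add: scalar_prod_def lessThan_atLeast0)
    thus ?thesis using e(1,2) that by simp
  qed
  moreover have "\<exists>c. \<forall>i<m. x i = c * e $ i"
    if x: "(\<Sum>i<m. \<Sum>j<m. cnj (x i) * H $$ (i, j) * x j) = 2 * (\<Sum>i<m. cnj (x i) * x i)" for x
  proof -
    obtain c where c: "vec m x = c \<cdot>\<^sub>v e" using e(3)[of "vec m x"] x unfolding form norm by auto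
    have "x i = c * e $ i" if "i < m" for i
    proof -
      have "vec m x $ i = (c \<cdot>\<^sub>v e) $ i" by (simp only: c)
      thus ?thesis using that e(1) by simp
    qed
    thus ?thesis by blast
  qed
  ultimately show "\<exists>e. (\<forall>i<m. (\<Sum>j<m. H $$ (i, j) * e j) = 2 * e i) \<and>
      (\<forall>x. (\<Sum>i<m. \<Sum>j<m. cnj (x i) * H $$ (i, j) * x j) = 2 * (\<Sum>i<m. cnj (x i) * x i) \<longrightarrow>
        (\<exists>c. \<forall>i<m. x i = c * e i))"
    by (intro exI[of _ "\<lambda>i. e $ i"]) blast
  show "x i = 0" if x: "(\<Sum>i<m. \<Sum>j<m. cnj (x i) * H $$ (i, j) * x j) = - 2 * (\<Sum>i<m. cnj (x i) * x i)"
    and i: "i < m" for x i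
  proof -
    have "vec m x = 0\<^sub>v m" by (rule minimal_form) (use x in \<open>simp_all add: form norm\<close>)
    hence "vec m x $ i = 0\<^sub>v m $ i" by (rule arg_cong)
    thus ?thesis using i by simp
  qed
qed

section \<open>From spectra of mixed graphs to characteristic polynomials\<close>

lemma hermitian_entry_cycle:
  assumes "i < m" "j < m"
  shows "hermitian_entry (undirected_cycle m) i j = cycle_adj m i j"
proof -
  have "{i, j} \<in> (\<lambda>a. {a, Suc a mod m}) ` {0..<m} \<longleftrightarrow> j = Suc i mod m \<or> i = Suc j mod m"
    using assms by (auto simp: doubleton_eq_iff image_iff)
  thus ?thesis by (simp add: hermitian_entry_def undirected_cycle_def cycle_adj_def)
qed

text \<open>As the spectrum is independent of the enumeration, the natural order of the vertices may
  be used.\<close>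

lemma spec_H_cycle: "spec_H (undirected_cycle m) = proots (char_poly (cycle_mat m))"
proof -
  have "hermitian_matrix_wrt [0..<m] (undirected_cycle m) = cycle_mat m"
    by (rule eq_matI) (auto simp: hermitian_matrix_wrt_def cycle_mat_def hermitian_entry_cycle)
  thus ?thesis using spec_H_enumeration[of "[0..<m]" "undirected_cycle m"]
    by (simp add: undirected_cycle_def)
qed

text \<open>A characteristic polynomial is monic, so over the complex numbers its roots determine
  it, and its degree is the order of the matrix. Hence cospectral graphs have equally many
  vertices.\<close>

lemma proots_char_poly_eqD:
  fixes A B :: "complex mat"
  assumes "A \<in> carrier_mat n n" "B \<in> carrier_mat k k" "proots (char_poly A) = proots (char_poly B)"
  shows "char_poly A = char_poly B" "n = k"
proof -
  have "char_poly X = (\<Prod>x\<in>#proots (char_poly X). [:- x, 1:])"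
    if "X \<in> carrier_mat l l" for X :: "complex mat" and l
    using complex_poly_decompose_multiset[of "char_poly X"] degree_monic_char_poly[OF that] by simp
  from this[OF assms(1)] this[OF assms(2)] assms(3) show eq: "char_poly A = char_poly B" by simp
  show "n = k" using degree_monic_char_poly[OF assms(1)] degree_monic_char_poly[OF assms(2)] eq by simp
qed

lemma hermitian_entry_swap:
  assumes "mixed_graph Y"
  shows "hermitian_entry Y y x = cnj (hermitian_entry Y x y)"
  using assms by (auto simp: hermitian_entry_def mixed_graph_def insert_commute)

lemma hermitian_entry_loop:
  assumes "mixed_graph Y"
  shows "hermitian_entry Y x x = 0"
  using assms by (force simp: hermitian_entry_def mixed_graph_def)

section \<open>Construction of the switched cycle\<close>

text \<open>The gain graph of Y yields a cyclic enumeration of its vertices together with switching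
  factors; Z is the undirected cycle drawn along this enumeration.\<close>

theorem DHS_odd_cycle:
  assumes odd_m: "odd m" and m3: "m \<ge> 3"
  shows "DHS TYPE('b) (undirected_cycle m)"
  unfolding DHS_def
proof (intro conjI allI impI)
  let ?X = "undirected_cycle m"
  show mgX: "mixed_graph ?X" by (rule mixed_graph_undirected_cycle[OF m3])
  fix Y :: "'b mixed_graph"
  assume Y: "mixed_graph Y" and spec: "spec_H Y = spec_H ?X"
  define vs where "vs = vertex_list (verts Y)"
  define H where "H = hermitian_matrix Y"
  have fin: "finite (verts Y)" using Y by (simp add: mixed_graph_def)
  note vl = vertex_list[OF fin, folded vs_def]
  have H0: "H \<in> carrier_mat (card (verts Y)) (card (verts Y))"
    by (simp add: H_def hermitian_matrix_def hermitian_matrix_wrt_def vl vs_def[symmetric])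
  have "proots (char_poly H) = proots (char_poly (cycle_mat m))"
    using spec unfolding spec_H_cycle by (simp add: spec_H_def H_def)
  note cp = proots_char_poly_eqD[OF H0 cycle_mat_carrier this]
  note len = vl(3)[unfolded cp(2)]
  have H: "H \<in> carrier_mat m m" using H0 by (simp add: cp(2))
  have Hij: "H $$ (i, j) = hermitian_entry Y (vs ! i) (vs ! j)" if "i < m" "j < m" for i j
    using that by (simp add: H_def hermitian_matrix_def hermitian_matrix_wrt_def len vs_def[symmetric])
  have "mat_adjoint H = H"
    using H by (intro eq_matI) (auto simp: Hij hermitian_entry_swap[OF Y, symmetric])
  then interpret cospectral_cycle m H using odd_m m3 H cp(1) by unfold_locales
  interpret gain_graph m "\<lambda>i j. H $$ (i, j)"
  proof (rule gain_graph)
    fix i j assume "i < m" "j < m" "H $$ (i, j) \<noteq> 0"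
    thus "H $$ (i, j) \<in> fourth_roots" by (auto simp: Hij hermitian_entry_def split: if_splits)
  next
    fix i assume "i < m"
    thus "H $$ (i, i) = 0" by (simp add: Hij hermitian_entry_loop[OF Y])
  qed
  obtain v d where v: "bij_betw v {..<m} {..<m}" and d: "\<And>i. i < m \<Longrightarrow> d i \<in> fourth_roots"
    and hv: "\<And>i j. i < m \<Longrightarrow> j < m \<Longrightarrow> H $$ (v i, v j) = cnj (d i) * cycle_adj m i j * d j"
    using switching_to_cycle by blast
  \<comment> \<open>Sends position i on the cycle to a vertex of \<open>Y\<close>, through the index
    \<open>v i\<close> in the vertex list.\<close>
  define b where "b i = vs ! v i" for i
  have "bij_betw (\<lambda>i. vs ! i) {..<m} (verts Y)"
    by (rule bij_betw_nth) (simp_all add: vl(1,2) len)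
  hence b: "bij_betw b {..<m} (verts Y)"
    using bij_betw_trans[OF v, of "\<lambda>i. vs ! i"] by (simp add: b_def[abs_def] comp_def)
  note binj = bij_betw_imp_inj_on[OF b] and bimg = bij_betw_imp_surj_on[OF b]
  define Z :: "'b mixed_graph" where
    "Z = \<lparr>verts = verts Y, edges = (\<lambda>e. b ` e) ` edges ?X, arcs = {}\<rparr>"
  have eX: "e \<subseteq> {..<m}" "card e = 2" if "e \<in> edges ?X" for e
    using mgX that by (auto simp: mixed_graph_def undirected_cycle_def)
  have eZ: "{b i, b j} \<in> edges Z \<longleftrightarrow> {i, j} \<in> edges ?X" if ij: "i < m" "j < m" for i j
  proof
    assume "{b i, b j} \<in> edges Z"
    then obtain e where e: "e \<in> edges ?X" "b ` {i, j} = b ` e" by (auto simp: Z_def)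
    have "{i, j} = e"
      using inj_on_image_eq_iff[OF binj, of "{i, j}" e] e(2) eX(1)[OF e(1)] ij by simp
    thus "{i, j} \<in> edges ?X" using e by simp
  next
    assume "{i, j} \<in> edges ?X"
    hence "b ` {i, j} \<in> edges Z" unfolding Z_def mixed_graph.simps by (rule imageI)
    thus "{b i, b j} \<in> edges Z" by simp
  qed
  have "mixed_graph Z"
    unfolding mixed_graph_def
  proof (intro conjI ballI)
    show "finite (verts Z)" using fin by (simp add: Z_def)
    fix e assume "e \<in> edges Z"
    then obtain e' where e': "e = b ` e'" "e' \<in> edges ?X" by (auto simp: Z_def)
    show "e \<subseteq> verts Z" using e' eX(1)[OF e'(2)] bimg by (auto simp: Z_def)
    show "card e = 2"
      using e'(1) eX[OF e'(2)] card_image[OF inj_on_subset[OF binj]] by simp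
  qed (auto simp: Z_def)
  moreover have "isomorphic Z ?X"
  proof -
    define g where "g = inv_into {..<m} b"
    have "bij_betw g (verts Z) (verts ?X)"
      using bij_betw_inv_into[OF b] by (simp add: g_def Z_def undirected_cycle_def lessThan_atLeast0)
    moreover have "{x, y} \<in> edges Z \<longleftrightarrow> {g x, g y} \<in> edges ?X" if xy: "x \<in> verts Z" "y \<in> verts Z" for x y
    proof -
      obtain i j where ij: "x = b i" "y = b j" "i < m" "j < m"
        using xy unfolding Z_def mixed_graph.simps bimg[symmetric] by blast
      have "g x = i" "g y = j" unfolding ij g_def using binj ij by (simp_all add: inv_into_f_f)
      thus ?thesis using eZ[OF ij(3,4)] ij(1,2) by simp
    qed
    moreover have "arcs Z = {}" "arcs ?X = {}" by (simp_all add: Z_def undirected_cycle_def)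
    ultimately show ?thesis unfolding isomorphic_def by blast
  qed
  moreover have "switching_equivalent Y Z"
  proof -
    \<comment> \<open>Rows and columns are indexed by the vertex list, the factors \<open>d\<close>
      by positions on the cycle; \<open>w\<close> converts the former into the latter.\<close>
    define w where "w = inv_into {..<m} v"
    have w: "w i < m" "v (w i) = i" if "i < m" for i
      using that bij_betw_inv_into_right[OF v] bij_betwE[OF bij_betw_inv_into[OF v]]
      by (auto simp: w_def)
    define D where "D = mat m m (\<lambda>(i, j). if i = j then d (w i) else 0)"
    \<comment> \<open>Conjugation inverts fourth roots of unity, so this is the inverse of
      \<open>D\<close>.\<close>
    define D' where "D' = mat m m (\<lambda>(i, j). if i = j then cnj (d (w i)) else 0)"
    have dd: "d i * cnj (d i) = 1" if "i < m" for i using d[OF that] by auto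
    have HZ: "hermitian_matrix Z = mat m m (\<lambda>(i, j). cycle_adj m (w i) (w j))"
    proof (rule eq_matI)
      fix i j assume "i < dim_row (mat m m (\<lambda>(i, j). cycle_adj m (w i) (w j)))"
        "j < dim_col (mat m m (\<lambda>(i, j). cycle_adj m (w i) (w j)))"
      hence ij: "i < m" "j < m" by auto
      have "hermitian_matrix Z $$ (i, j) = hermitian_entry Z (b (w i)) (b (w j))"
        using ij w
        by (simp add: hermitian_matrix_def hermitian_matrix_wrt_def Z_def vs_def[symmetric] len b_def)
      also have "\<dots> = hermitian_entry ?X (w i) (w j)"
        using eZ[OF w(1)[OF ij(1)] w(1)[OF ij(2)]]
        by (simp add: hermitian_entry_def) (simp add: Z_def undirected_cycle_def)
      also have "\<dots> = cycle_adj m (w i) (w j)" by (rule hermitian_entry_cycle) (use ij w in auto)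
      finally show "hermitian_matrix Z $$ (i, j) = mat m m (\<lambda>(i, j). cycle_adj m (w i) (w j)) $$ (i, j)"
        using ij by simp
    qed (auto simp: hermitian_matrix_def hermitian_matrix_wrt_def Z_def vs_def[symmetric] len)
    have DH: "D' * hermitian_matrix Z = mat m m (\<lambda>(i, j). cnj (d (w i)) * cycle_adj m (w i) (w j))"
      unfolding HZ
      by (rule eq_matI) (auto simp: D'_def scalar_prod_def if_distrib[of "\<lambda>x. x * _"] cong: if_cong)
    have "H = D' * hermitian_matrix Z * D"
      unfolding DH
    proof (rule eq_matI)
      fix i j
      assume "i < dim_row (mat m m (\<lambda>(i, j). cnj (d (w i)) * cycle_adj m (w i) (w j)) * D)"
        "j < dim_col (mat m m (\<lambda>(i, j). cnj (d (w i)) * cycle_adj m (w i) (w j)) * D)"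
      hence ij: "i < m" "j < m" by (auto simp: D_def)
      have "H $$ (i, j) = cnj (d (w i)) * cycle_adj m (w i) (w j) * d (w j)"
        using hv[OF w(1)[OF ij(1)] w(1)[OF ij(2)]] w(2) ij by simp
      thus "H $$ (i, j) = (mat m m (\<lambda>(i, j). cnj (d (w i)) * cycle_adj m (w i) (w j)) * D) $$ (i, j)"
        using ij by (simp add: D_def scalar_prod_def if_distrib[of "\<lambda>x. _ * x"] cong: if_cong)
    qed (use H in \<open>auto simp: D_def\<close>)
    moreover have "inverts_mat D D'" "inverts_mat D' D"
      unfolding inverts_mat_def
      by (rule eq_matI; auto simp: D_def D'_def scalar_prod_def if_distrib[of "\<lambda>x. x * _"]
            if_distrib[of "\<lambda>x. _ * x"] dd w mult.commute cong: if_cong)+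
    moreover have "D \<in> carrier_mat m m" "D' \<in> carrier_mat m m" "diagonal_mat D"
      by (auto simp: D_def D'_def diagonal_mat_def)
    moreover have "\<forall>j<m. D $$ (j, j) \<in> fourth_roots" using d w by (simp add: D_def)
    ultimately show ?thesis
      unfolding switching_equivalent_def cp(2) H_def by (intro conjI exI[of _ D] exI[of _ D']) (simp_all add: Z_def)
  qed
  ultimately show "\<exists>Z :: 'b mixed_graph. mixed_graph Z \<and> isomorphic Z ?X \<and> switching_equivalent Y Z"
    by blast
qed

theorem theorem4p6:
  fixes n :: nat
  assumes "n > 0"
  shows "DHS TYPE('b) (undirected_cycle (2 * n + 1))"
  by (rule DHS_odd_cycle) (use assms in auto)

end
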